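(* If a quiver $Q$ has a totally proper cyclic ordering $\sigma$, then running the algorithm described in the context with input $Q$ will produce a cyclic ordering $\sigma_Q$ wiggle equivalent to $\sigma$. (That is, for any choice made by the algorithm of chordless cycles spanning $H_1(K_Q)$, the algorithm does not output $\varnothing$, and its output $\sigma_Q$ is such that $(Q,\sigma_Q)$ is wiggle equivalent to $(Q,\sigma)$.)
   Context: A quiver is a finite directed graph without loops or oriented 2-cycles; multiple arrows are allowed; vertices are labeled. $K_Q$ is the underlying undirected simple graph of $Q$. Mutation $\mu_j$ of a quiver at a vertex $j$: for each path $i\to j\to k$ add an arrow $i\to k$; reverse all arrows incident to $j$; repeatedly remove oriented 2-cycles. A cyclic ordering $\sigma=(v_1,\dots,v_n)$ of the vertex set is a linear ordering considered up to cyclic shifts ("clockwise" placement on a circle). A cyclically ordered quiver (COQ) $(Q,\sigma)$ is a quiver with a cyclic ordering of its vertices. A wiggle transforms $(Q,\sigma)$ into $(Q,\sigma')$ where $\sigma'$ is obtained from $\sigma$ by interchanging two vertices that are consecutive in $\sigma$ and not adjacent in $Q$. Wiggle equivalence is the equivalence relation generated by wiggles. A path $i\to j\to k$ in $Q$ makes a right turn at $j$ if $\sigma=(\dots,i,\dots,j,\dots,k,\dots)$. A vertex $j$ is proper in $(Q,\sigma)$ if every oriented two-arrow path $i\to j\to k$ makes a right turn at $j$. A COQ $(Q,\sigma)$ is proper if for every vertex $j$ there is a COQ wiggle equivalent to $(Q,\sigma)$ in which $j$ is proper. Let $\operatorname{In}(j)$ (resp., $\operatorname{Out}(j)$) be the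 set of vertices $i$ with an arrow $i\to j$ (resp., $j\to i$). If $j$ is proper in $(Q,\sigma)$, the proper mutation $\mu_j(Q,\sigma)$ is the quiver $\mu_j(Q)$ with the cyclic ordering obtained from $\sigma$ by keeping the placement of all vertices other than $j$ and moving $j$ clockwise past all the vertices in $\operatorname{Out}(j)$ (each exactly once) without passing any vertex in $\operatorname{In}(j)$ (well defined up to wiggles; for a sink or source $j$ the cyclic ordering does not change, up to wiggles). The proper mutation class of a COQ consists of all COQs obtained from it by repeated proper mutations and wiggles. A COQ is totally proper if all COQs in its proper mutation class are proper; $\sigma$ is a totally proper cyclic ordering of $Q$ if $(Q,\sigma)$ is totally proper. Winding numbers: for $\sigma=(v_1,\dots,v_n)$ and $a=v_i$, $b=v_j$, set $\theta(\sigma,a,b)=j-i$ if $i\le j$ and $n+j-i$ if $i>j$. For a cycle $C=(u_0-u_1-\cdots-u_k=u_0)$ in $K_Q$ with a chosen direction of traversal, let $\ell$ be the number of $i\in\{0,\dots,k-1\}$ such that $Q$ contains an arrow $u_i\leftarrow u_{i+1}$; then $\operatorname{wind}(C,\sigma)=\frac1n\sum_{i=0}^{k-1}\theta(\sigma,u_i,u_{i+1})-\ell$. The algorithm. Input: a quiver $Q$. Choose a set of chordless cycles $C_i$ (with directions of traversal) that form a spanning set of $H_1(K_Q)=H_1(K_Q,\mathbb Z)$. Prescribe $w_i=1$ (resp., $-1$) if $C_i$ lifts to an oriented cycle in $Q$ whose arrows agree with (resp., are opposite to) the direction of traversal, and $w_i=0$ if $C_i$ does not lift to an oriented cycle in $Q$.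 Find a cyclic ordering $\sigma_Q$ of the vertices of $Q$ with $\operatorname{wind}(C_i,\sigma_Q)=w_i$ for all $i$ (this can be done by linear programming), and output it; if no such cyclic ordering exists, output $\varnothing$. *)

theory Defs
  imports Complex_Main
begin

section \<open>Quivers and mutation\<close>

text \<open>A quiver is given by its vertex set and arrow multiplicities:
  \<open>arr Q i j\<close> is the number of arrows \<open>i \<rightarrow> j\<close>.\<close>

record 'a quiver =
  verts :: "'a set"
  arr :: "'a \<Rightarrow> 'a \<Rightarrow> nat"

definition quiver :: "'a quiver \<Rightarrow> bool" where
  "quiver Q \<longleftrightarrow>
     finite (verts Q) \<and>
     (\<forall>i j. arr Q i j > 0 \<longrightarrow> i \<in> verts Q \<and> j \<in> verts Q) \<and>
     (\<forall>i. arr Q i i = 0) \<and>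
     (\<forall>i j. arr Q i j > 0 \<longrightarrow> arr Q j i = 0)"

definition in_nbrs :: "'a quiver \<Rightarrow> 'a \<Rightarrow> 'a set" where
  "in_nbrs Q j = {i. arr Q i j > 0}"

definition out_nbrs :: "'a quiver \<Rightarrow> 'a \<Rightarrow> 'a set" where
  "out_nbrs Q j = {k. arr Q j k > 0}"

text \<open>The edge relation of the underlying simple graph \<open>K\<^sub>Q\<close>.\<close>

definition adjacent :: "'a quiver \<Rightarrow> 'a \<Rightarrow> 'a \<Rightarrow> bool" where
  "adjacent Q i j \<longleftrightarrow> arr Q i j > 0 \<or> arr Q j i > 0"

definition compose_paths :: "'a \<Rightarrow> 'a quiver \<Rightarrow> 'a quiver" where
  "compose_paths j Q = Q\<lparr>arr := \<lambda>i k. arr Q i k + arr Q i j * arr Q j k\<rparr>"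

definition reverse_at :: "'a \<Rightarrow> 'a quiver \<Rightarrow> 'a quiver" where
  "reverse_at j Q = Q\<lparr>arr := \<lambda>i k. if i = j \<or> k = j then arr Q k i else arr Q i k\<rparr>"

text \<open>The truncated subtraction is what remains after removing oriented 2-cycles as long as possible.\<close>

definition cancel_two_cycles :: "'a quiver \<Rightarrow> 'a quiver" where
  "cancel_two_cycles Q = Q\<lparr>arr := \<lambda>i k. arr Q i k - arr Q k i\<rparr>"

definition mutate :: "'a \<Rightarrow> 'a quiver \<Rightarrow> 'a quiver" where
  "mutate j Q = cancel_two_cycles (reverse_at j (compose_paths j Q))"

lemma verts_mutate [simp]: "verts (mutate j Q) = verts Q"
  by (simp add: mutate_def cancel_two_cycles_def reverse_at_def compose_paths_def)

lemma quiver_mutate: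
  assumes "quiver Q"
  shows "quiver (mutate j Q)"
proof -
  have supp: "arr Q a b > 0 \<Longrightarrow> a \<in> verts Q \<and> b \<in> verts Q" for a b
    using assms by (auto simp: quiver_def)
  have *: "i \<in> verts Q \<and> k \<in> verts Q" if "arr (mutate j Q) i k > 0" for i k
  proof -
    have "arr Q i k > 0 \<or> arr Q k i > 0 \<or> (arr Q i j > 0 \<and> arr Q j k > 0)
        \<or> (arr Q k j > 0 \<and> arr Q j i > 0)"
      using that
      by (auto simp: mutate_def cancel_two_cycles_def reverse_at_def compose_paths_def
               split: if_splits)
    then show ?thesis using supp by blast
  qed
  have "arr (mutate j Q) i i = 0"
    and "arr (mutate j Q) i k > 0 \<Longrightarrow> arr (mutate j Q) k i = 0" for i k
    by (auto simp: mutate_def cancel_two_cycles_def)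
  then show ?thesis
    using * assms by (simp add: quiver_def)
qed


section \<open>Cyclic orderings and wiggles\<close>

text \<open>A cyclic ordering is a linear ordering (a duplicate-free list of all vertices, read clockwise)
  up to cyclic shifts, i.e. a rotation class of such lists.\<close>

definition cyc :: "'a list \<Rightarrow> 'a list set" where
  "cyc vs = {rotate m vs | m. True}"

definition cyclic_ordering :: "'a set \<Rightarrow> 'a list set \<Rightarrow> bool" where
  "cyclic_ordering V \<sigma> \<longleftrightarrow> (\<exists>vs. distinct vs \<and> set vs = V \<and> \<sigma> = cyc vs)"

text \<open>Since \<open>\<sigma>\<close> may be cut open anywhere, two cyclically consecutive vertices can
  be taken to be the first two entries.\<close>

definition wiggle :: "'a quiver \<Rightarrow> 'a list set \<Rightarrow> 'a list set \<Rightarrow> bool" where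
  "wiggle Q \<sigma> \<sigma>' \<longleftrightarrow>
     (\<exists>a b vs. \<sigma> = cyc (a # b # vs) \<and> \<sigma>' = cyc (b # a # vs) \<and> \<not> adjacent Q a b)"

definition wiggle_equivalent :: "'a quiver \<Rightarrow> 'a list set \<Rightarrow> 'a list set \<Rightarrow> bool" where
  "wiggle_equivalent Q = equivclp (wiggle Q)"


section \<open>Proper vertices, proper mutations, total properness\<close>

definition right_turn :: "'a list set \<Rightarrow> 'a \<Rightarrow> 'a \<Rightarrow> 'a \<Rightarrow> bool" where
  "right_turn \<sigma> i j k \<longleftrightarrow> (\<exists>ws xs ys zs. ws @ [i] @ xs @ [j] @ ys @ [k] @ zs \<in> \<sigma>)"

definition proper_vertex :: "'a quiver \<Rightarrow> 'a list set \<Rightarrow> 'a \<Rightarrow> bool" where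
  "proper_vertex Q \<sigma> j \<longleftrightarrow>
     (\<forall>i k. arr Q i j > 0 \<and> arr Q j k > 0 \<longrightarrow> right_turn \<sigma> i j k)"

definition proper :: "'a quiver \<Rightarrow> 'a list set \<Rightarrow> bool" where
  "proper Q \<sigma> \<longleftrightarrow>
     (\<forall>j\<in>verts Q. \<exists>\<sigma>'. wiggle_equivalent Q \<sigma> \<sigma>' \<and> proper_vertex Q \<sigma>' j)"

text \<open>The new position of \<open>j\<close> is only determined up to wiggles, so the effect of a proper
  mutation on the cyclic ordering is a relation. Below, \<open>xs\<close> are the vertices
  that \<open>j\<close> passes when moving clockwise.\<close>

definition moved_past_out :: "'a quiver \<Rightarrow> 'a \<Rightarrow> 'a list set \<Rightarrow> 'a list set \<Rightarrow> bool" where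
  "moved_past_out Q j \<sigma> \<sigma>' \<longleftrightarrow>
     (\<exists>xs ys. \<sigma> = cyc (j # xs @ ys) \<and> \<sigma>' = cyc (xs @ j # ys) \<and>
        out_nbrs Q j \<subseteq> set xs \<and> set xs \<inter> in_nbrs Q j = {})"

inductive in_proper_mutation_class ::
    "'a quiver \<Rightarrow> 'a list set \<Rightarrow> 'a quiver \<Rightarrow> 'a list set \<Rightarrow> bool"
  for Q :: "'a quiver" and \<sigma> :: "'a list set" where
  refl: "in_proper_mutation_class Q \<sigma> Q \<sigma>"
| wiggle: "in_proper_mutation_class Q \<sigma> R \<tau> \<Longrightarrow> wiggle R \<tau> \<tau>' \<Longrightarrow>
    in_proper_mutation_class Q \<sigma> R \<tau>'"
| mutation: "in_proper_mutation_class Q \<sigma> R \<tau> \<Longrightarrow> j \<in> verts R \<Longrightarrow> proper_vertex R \<tau> j \<Longrightarrow>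
    moved_past_out R j \<tau> \<tau>' \<Longrightarrow> in_proper_mutation_class Q \<sigma> (mutate j R) \<tau>'"

definition totally_proper :: "'a quiver \<Rightarrow> 'a list set \<Rightarrow> bool" where
  "totally_proper Q \<sigma> \<longleftrightarrow> (\<forall>R \<tau>. in_proper_mutation_class Q \<sigma> R \<tau> \<longrightarrow> proper R \<tau>)"


section \<open>Cycles and the first homology group of the underlying graph\<close>

text \<open>A cycle \<open>(u\<^sub>0 - u\<^sub>1 - \<dots> - u\<^sub>k = u\<^sub>0)\<close> with a direction of traversal is the list
  \<open>[u\<^sub>0, \<dots>, u\<^sub>k\<^sub>-\<^sub>1]\<close>; \<open>cycle_nth\<close> reads indices modulo \<open>k\<close>.\<close>

definition cycle_nth :: "'a list \<Rightarrow> nat \<Rightarrow> 'a" where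
  "cycle_nth C i = C ! (i mod length C)"

definition graph_cycle :: "'a quiver \<Rightarrow> 'a list \<Rightarrow> bool" where
  "graph_cycle Q C \<longleftrightarrow> length C \<ge> 3 \<and> distinct C \<and> set C \<subseteq> verts Q \<and>
     (\<forall>i<length C. adjacent Q (cycle_nth C i) (cycle_nth C (i + 1)))"

definition chordless_cycle :: "'a quiver \<Rightarrow> 'a list \<Rightarrow> bool" where
  "chordless_cycle Q C \<longleftrightarrow> graph_cycle Q C \<and>
     (\<forall>i<length C. \<forall>j<length C. adjacent Q (C ! i) (C ! j) \<longrightarrow>
        j = (i + 1) mod length C \<or> i = (j + 1) mod length C)"

text \<open>Simplicial 1-chains of \<open>K\<^sub>Q\<close> with integer coefficients are antisymmetric functions on ordered
  pairs supported on edges: \<open>c u v\<close> is the coefficient of the edge oriented from \<open>u\<close> to \<open>v\<close>.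
  As there are no 2-simplices, \<open>H\<^sub>1(K\<^sub>Q)\<close> is the kernel of the boundary map.\<close>

definition H1 :: "'a quiver \<Rightarrow> ('a \<Rightarrow> 'a \<Rightarrow> int) set" where
  "H1 Q = {c. (\<forall>u v. c v u = - c u v) \<and> (\<forall>u v. c u v \<noteq> 0 \<longrightarrow> adjacent Q u v) \<and>
              (\<forall>v\<in>verts Q. (\<Sum>u\<in>verts Q. c u v) = 0)}"

definition cycle_class :: "'a list \<Rightarrow> 'a \<Rightarrow> 'a \<Rightarrow> int" where
  "cycle_class C u v =
     (\<Sum>i<length C. of_bool (cycle_nth C i = u \<and> cycle_nth C (i + 1) = v)
                  - of_bool (cycle_nth C i = v \<and> cycle_nth C (i + 1) = u))"

text \<open>The set \<open>\<C>\<close> below is automatically finite for a quiver,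
  see \<open>finite_chordless_cycles\<close>.\<close>

definition spans_H1 :: "'a quiver \<Rightarrow> 'a list set \<Rightarrow> bool" where
  "spans_H1 Q \<C> \<longleftrightarrow>
     (\<forall>c\<in>H1 Q. \<exists>f :: 'a list \<Rightarrow> int. c = (\<lambda>u v. \<Sum>C\<in>\<C>. f C * cycle_class C u v))"

lemma finite_chordless_cycles:
  assumes "quiver Q"
  shows "finite {C. chordless_cycle Q C}"
proof (rule finite_subset)
  have fin: "finite (verts Q)" using assms by (simp add: quiver_def)
  show "finite {C. set C \<subseteq> verts Q \<and> length C \<le> card (verts Q)}"
    using finite_lists_length_le[OF fin] .
  show "{C. chordless_cycle Q C} \<subseteq> {C. set C \<subseteq> verts Q \<and> length C \<le> card (verts Q)}"
    using fin by (auto simp: chordless_cycle_def graph_cycle_def)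
      (metis card_mono distinct_card)
qed


section \<open>Winding numbers\<close>

definition pos :: "'a list \<Rightarrow> 'a \<Rightarrow> nat" where
  "pos vs a = (THE i. i < length vs \<and> vs ! i = a)"

definition lin_theta :: "'a list \<Rightarrow> 'a \<Rightarrow> 'a \<Rightarrow> int" where
  "lin_theta vs a b =
     (let i = int (pos vs a); j = int (pos vs b)
      in if i \<le> j then j - i else int (length vs) + j - i)"

text \<open>The value does not depend on the linear representative, see \<open>theta_cyc\<close>.\<close>

definition theta :: "'a list set \<Rightarrow> 'a \<Rightarrow> 'a \<Rightarrow> int" where
  "theta \<sigma> a b = lin_theta (SOME vs. vs \<in> \<sigma>) a b"

lemma pos_nth: "distinct vs \<Longrightarrow> i < length vs \<Longrightarrow> pos vs (vs ! i) = i"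
  unfolding pos_def by (rule the_equality) (auto simp: nth_eq_iff_index_eq)

lemma lin_theta_nth:
  assumes "distinct vs" "i < length vs" "j < length vs"
  shows "lin_theta vs (vs ! i) (vs ! j) = (int j - int i) mod int (length vs)"
proof (cases "i \<le> j")
  case True
  then show ?thesis using assms by (simp add: lin_theta_def pos_nth)
next
  case False
  then have "(int j - int i) mod int (length vs) = (int j - int i + int (length vs)) mod int (length vs)"
    by simp
  also have "\<dots> = int j - int i + int (length vs)"
    using False assms by (intro mod_pos_pos_trivial) auto
  finally show ?thesis using False assms by (simp add: lin_theta_def pos_nth)
qed

lemma lin_theta_rotate:
  assumes "distinct vs" "a \<in> set vs" "b \<in> set vs"
  shows "lin_theta (rotate m vs) a b = lin_theta vs a b"
proof -
  let ?n = "length vs"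
  from assms obtain i j where
    ij: "i < ?n" "rotate m vs ! i = a" "j < ?n" "rotate m vs ! j = b"
    by (metis in_set_conv_nth length_rotate set_rotate)
  have a: "a = vs ! ((m + i) mod ?n)" and b: "b = vs ! ((m + j) mod ?n)"
    using ij by (auto simp: nth_rotate)
  have n: "?n > 0" using ij by linarith
  have "lin_theta vs a b = (int ((m + j) mod ?n) - int ((m + i) mod ?n)) mod int ?n"
    unfolding a b using n by (intro lin_theta_nth assms) auto
  also have "\<dots> = (int (m + j) - int (m + i)) mod int ?n"
    by (simp add: zmod_int mod_diff_eq)
  also have "\<dots> = (int j - int i) mod int ?n" by simp
  also have "\<dots> = lin_theta (rotate m vs) a b"
    using lin_theta_nth[of "rotate m vs" i j] ij assms by simp
  finally show ?thesis ..
qed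

lemma theta_cyc:
  assumes "distinct vs" "a \<in> set vs" "b \<in> set vs"
  shows "theta (cyc vs) a b = lin_theta vs a b"
proof -
  have "vs \<in> cyc vs" unfolding cyc_def by (auto intro: exI[of _ 0])
  then have "(SOME ws. ws \<in> cyc vs) \<in> cyc vs" by (rule someI)
  then obtain m where "(SOME ws. ws \<in> cyc vs) = rotate m vs" by (auto simp: cyc_def)
  then show ?thesis using assms by (simp add: theta_def lin_theta_rotate)
qed

definition wind :: "'a quiver \<Rightarrow> 'a list \<Rightarrow> 'a list set \<Rightarrow> rat" where
  "wind Q C \<sigma> =
     1 / of_nat (card (verts Q)) *
       of_int (\<Sum>i<length C. theta \<sigma> (cycle_nth C i) (cycle_nth C (i + 1)))
     - of_nat (card {i. i < length C \<and> arr Q (cycle_nth C (i + 1)) (cycle_nth C i) > 0})"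


section \<open>The algorithm\<close>

definition prescribed_wind :: "'a quiver \<Rightarrow> 'a list \<Rightarrow> int" where
  "prescribed_wind Q C =
     (if \<forall>i<length C. arr Q (cycle_nth C i) (cycle_nth C (i + 1)) > 0 then 1
      else if \<forall>i<length C. arr Q (cycle_nth C (i + 1)) (cycle_nth C i) > 0 then -1
      else 0)"

definition admissible_choice :: "'a quiver \<Rightarrow> 'a list set \<Rightarrow> bool" where
  "admissible_choice Q \<C> \<longleftrightarrow> (\<forall>C\<in>\<C>. chordless_cycle Q C) \<and> spans_H1 Q \<C>"

definition solutions :: "'a quiver \<Rightarrow> 'a list set \<Rightarrow> 'a list set set" where
  "solutions Q \<C> = {\<sigma>. cyclic_ordering (verts Q) \<sigma> \<and>
                      (\<forall>C\<in>\<C>. wind Q C \<sigma> = of_int (prescribed_wind Q C))}"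

text \<open>The possible outputs, given a choice \<open>\<C>\<close> of cycles; the algorithm may return any solution, and
  \<open>None\<close> stands for the output \<open>\<emptyset>\<close>.\<close>

definition algorithm_outputs :: "'a quiver \<Rightarrow> 'a list set \<Rightarrow> 'a list set option set" where
  "algorithm_outputs Q \<C> =
     (if solutions Q \<C> = {} then {None} else Some ` solutions Q \<C>)"

end

theory Submission
  imports Defs
begin

text \<open>Let \<open>n\<close> be the number of vertices. Up to coboundaries, the winding number of a cycle is the sum along it
  of a cochain, which moving a vertex past another one changes only on the edge joining the two. Hence
  wiggles preserve winding numbers, and so does a proper mutation at a vertex \<open>j\<close> of a chordless cycle
  \<open>C\<close>: if \<open>C\<close> passes through \<open>i \<rightarrow> j \<rightarrow> k\<close> it turns \<open>C\<close> into a chordless cycle through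
  \<open>i \<rightarrow> k\<close> that is shorter by one, and if \<open>j\<close> is a source or a sink of \<open>C\<close> it reverses the two
  arrows at \<open>j\<close>, after which \<open>C\<close> has a vertex of the first kind. Descending to triangles, where
  properness is the assertion, one sees that every chordless cycle of a totally proper quiver winds as
  prescribed, so \<open>\<sigma>\<close> is a solution.

  Conversely, if two cyclic orderings have the same winding numbers on a spanning set of \<open>H\<^sub>1\<close>, then the
  difference of their cochains is the coboundary of some integer function on the vertices, so the orderings
  lift to injective-mod-\<open>n\<close> functions \<open>x, y\<close> from vertices to the integers such that
  \<open>x v - x u\<close> and \<open>y v - y u\<close> lie between the same multiples of \<open>n\<close> whenever \<open>u\<close> and \<open>v\<close>
  are adjacent. Unless \<open>y - x\<close> is constant, it descends from some \<open>u\<close> to the vertex \<open>v\<close> that follows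
  it in the ordering given by \<open>x\<close>; these are then not adjacent, and interchanging them decreases the sum of
  the squares of \<open>y - x\<close>.\<close>

section \<open>Sums along cycles\<close>

text \<open>This evaluates a 1-cochain on a closed walk. Pairing \<open>C\<close> with
  \<open>rotate1 C\<close>, instead of using indices, lets vertices be deleted and cycles be rotated
  or reversed by list rewriting.\<close>

definition cycle_sum :: "('a \<Rightarrow> 'a \<Rightarrow> int) \<Rightarrow> 'a list \<Rightarrow> int" where
  "cycle_sum f C = (\<Sum>(u, v)\<leftarrow>zip C (rotate1 C). f u v)"

definition cycle_edges :: "'a list \<Rightarrow> ('a \<times> 'a) set" where
  "cycle_edges C = set (zip C (rotate1 C))"

lemma cycle_edges_in_set: "(u, v) \<in> cycle_edges C \<Longrightarrow> u \<in> set C \<and> v \<in> set C"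
  unfolding cycle_edges_def by (metis set_rotate1 set_zip_leftD set_zip_rightD)

lemma cycle_edges_conv: "cycle_edges C = {(cycle_nth C i, cycle_nth C (i + 1)) | i. i < length C}"
  by (force simp: cycle_edges_def set_zip cycle_nth_def nth_rotate1)

lemma cycle_sum_conv:
  "cycle_sum f C = (\<Sum>i<length C. f (cycle_nth C i) (cycle_nth C (i + 1)))"
  unfolding cycle_sum_def
  by (simp add: sum_list_sum_nth atLeast0LessThan cycle_nth_def nth_rotate1)

text \<open>The tail sum is literally the one in \<open>cycle_sum_Cons2\<close>, so deleting
  \<open>j\<close> trades the two edges at \<open>j\<close> for the edge from \<open>i\<close> to
  \<open>k\<close> and leaves the rest alone.\<close>

lemma cycle_sum_Cons3:
  "cycle_sum f (i # j # k # r) = f i j + f j k + (\<Sum>(u, v)\<leftarrow>zip (k # r) (r @ [i]). f u v)"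
  by (simp add: cycle_sum_def)

lemma cycle_sum_Cons2:
  "cycle_sum f (i # k # r) = f i k + (\<Sum>(u, v)\<leftarrow>zip (k # r) (r @ [i]). f u v)"
  by (simp add: cycle_sum_def)

lemma cycle_sum_cong:
  assumes "\<And>u v. (u, v) \<in> cycle_edges C \<Longrightarrow> f u v = f' u v"
  shows "cycle_sum f C = cycle_sum f' C"
  unfolding cycle_sum_def using assms
  by (intro arg_cong[where f = sum_list] map_cong) (auto simp: cycle_edges_def)

lemma cycle_sum_add: "cycle_sum (\<lambda>u v. f u v + f' u v) C = cycle_sum f C + cycle_sum f' C"
  by (simp add: cycle_sum_conv sum.distrib)

lemma cycle_sum_diff: "cycle_sum (\<lambda>u v. f u v - f' u v) C = cycle_sum f C - cycle_sum f' C"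
  by (simp add: cycle_sum_conv sum_subtractf)

lemma cycle_sum_mult: "cycle_sum (\<lambda>u v. m * f u v) C = m * cycle_sum f C"
  by (simp add: cycle_sum_conv sum_distrib_left)

lemma zip_rotate1: "length xs = length ys \<Longrightarrow> zip (rotate1 xs) (rotate1 ys) = rotate1 (zip xs ys)"
  by (cases xs; cases ys) auto

lemma cycle_edges_rotate1 [simp]: "cycle_edges (rotate1 C) = cycle_edges C"
  by (simp add: cycle_edges_def zip_rotate1)

lemma sum_list_rotate1: "sum_list (map f (rotate1 xs)) = (sum_list (map f xs) :: int)"
  by (cases xs) auto

lemma cycle_sum_rotate1 [simp]: "cycle_sum f (rotate1 C) = cycle_sum f C"
  by (simp add: cycle_sum_def zip_rotate1 sum_list_rotate1)

text \<open>The sum telescopes: the heads of the edges form the list \<open>rotate1 C\<close>, their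
  tails form \<open>C\<close>, and \<open>g\<close> has the same sum over both.\<close>

lemma cycle_sum_coboundary: "cycle_sum (\<lambda>u v. g v - g u) C = 0"
proof -
  have "map (\<lambda>(u, v). g v) (zip C (rotate1 C)) = map g (rotate1 C)"
    by (simp add: list_eq_iff_nth_eq)
  moreover have "map (\<lambda>(u, v). g u) (zip C (rotate1 C)) = map g C"
    by (simp add: list_eq_iff_nth_eq)
  ultimately have "cycle_sum (\<lambda>u v. g v) C = sum_list (map g (rotate1 C))"
    "cycle_sum (\<lambda>u v. g u) C = sum_list (map g C)"
    by (simp_all only: cycle_sum_def)
  then show ?thesis by (simp add: cycle_sum_diff sum_list_rotate1)
qed

text \<open>Among the rotations of the reversed cycle, the one starting at \<open>k\<close> keeps
  \<open>j\<close> in second place, so that facts about the second vertex apply to both directions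
  of traversal.\<close>

lemma zip_reverse:
  "zip (k # j # i # rev r) (j # i # rev r @ [k]) =
   map prod.swap ([(j, k), (i, j)] @ rev (zip (k # r) (r @ [i])))"
proof -
  have "rev (zip (k # r) (r @ [i])) = zip (rev r @ [k]) (i # rev r)"
    using zip_rev[of "k # r" "r @ [i]"] by simp
  then show ?thesis by (simp add: zip_commute[of "i # rev r"] prod.swap_def case_prod_beta)
qed

lemma cycle_edges_reverse: "cycle_edges (k # j # i # rev r) = (cycle_edges (i # j # k # r))\<inverse>"
  using arg_cong[OF zip_reverse[of k j i r], of set] by (auto simp: cycle_edges_def)

lemma cycle_sum_reverse: "cycle_sum f (k # j # i # rev r) = cycle_sum (\<lambda>u v. f v u) (i # j # k # r)"
  using arg_cong[OF zip_reverse[of k j i r], of "\<lambda>l. sum_list (map (\<lambda>(u, v). f u v) l)"]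
  by (simp add: cycle_sum_def rev_map[symmetric] case_prod_unfold comp_def)

section \<open>Chordless cycles described by their edge sets\<close>

lemma adjacent_sym: "adjacent Q u v \<longleftrightarrow> adjacent Q v u"
  by (auto simp: adjacent_def)

lemma adjacent_in_verts: "quiver Q \<Longrightarrow> adjacent Q u v \<Longrightarrow> u \<in> verts Q \<and> v \<in> verts Q \<and> u \<noteq> v"
  by (auto simp: quiver_def adjacent_def)

text \<open>The index condition modulo the length becomes a condition on the edge set, which
  rotation preserves and reversal turns into its converse. That edges are adjacent makes
  \<open>C\<close> a cycle; the other implication excludes chords.\<close>

lemma chordless_cycle_conv:
  "chordless_cycle Q C \<longleftrightarrow> length C \<ge> 3 \<and> distinct C \<and> set C \<subseteq> verts Q \<and>
     (\<forall>u\<in>set C. \<forall>v\<in>set C. adjacent Q u v \<longleftrightarrow> (u, v) \<in> cycle_edges C \<or> (v, u) \<in> cycle_edges C)"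
  (is "?L \<longleftrightarrow> ?R")
proof (cases "length C \<ge> 3 \<and> distinct C")
  case True
  have edge: "(C ! i, C ! j) \<in> cycle_edges C \<longleftrightarrow> j = (i + 1) mod length C"
    if "i < length C" "j < length C" for i j
  proof -
    have "length C > 0" using that by auto
    then have "(i' + 1) mod length C < length C" for i' by simp
    then show ?thesis
      using that True by (force simp: cycle_edges_conv cycle_nth_def nth_eq_iff_index_eq)
  qed
  have "?R \<longleftrightarrow> set C \<subseteq> verts Q \<and> (\<forall>i<length C. \<forall>j<length C. adjacent Q (C ! i) (C ! j) \<longleftrightarrow>
     (C ! i, C ! j) \<in> cycle_edges C \<or> (C ! j, C ! i) \<in> cycle_edges C)"
    using True by (simp add: all_set_conv_all_nth)
  also have "\<dots> \<longleftrightarrow> set C \<subseteq> verts Q \<and> (\<forall>i<length C. \<forall>j<length C. adjacent Q (C ! i) (C ! j) \<longleftrightarrow>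
     j = (i + 1) mod length C \<or> i = (j + 1) mod length C)"
    by (simp add: edge cong: conj_cong)
  also have "\<dots> \<longleftrightarrow> ?L"
  proof -
    have "(i + 1) mod length C < length C" if "i < length C" for i
      using that by (intro mod_less_divisor) auto
    then show ?thesis
      using True unfolding chordless_cycle_def graph_cycle_def cycle_nth_def
      by (auto simp: adjacent_sym) 
  qed
  finally show ?thesis ..
qed (auto simp: chordless_cycle_def graph_cycle_def)

lemma cycle_edges_adjacent:
  assumes "chordless_cycle Q C" "(u, v) \<in> cycle_edges C"
  shows "adjacent Q u v"
  using assms cycle_edges_in_set[OF assms(2)] by (auto simp: chordless_cycle_conv)

lemma chordless_cycle_rotate1: "chordless_cycle Q C \<Longrightarrow> chordless_cycle Q (rotate1 C)"
  by (simp add: chordless_cycle_conv)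

lemma chordless_cycle_reverse:
  "chordless_cycle Q (i # j # k # r) \<Longrightarrow> chordless_cycle Q (k # j # i # rev r)"
  unfolding chordless_cycle_conv cycle_edges_reverse by auto

lemma prescribed_wind_conv:
  "prescribed_wind Q C =
     (if \<forall>(u, v)\<in>cycle_edges C. arr Q u v > 0 then 1
      else if \<forall>(u, v)\<in>cycle_edges C. arr Q v u > 0 then -1 else 0)"
proof -
  have "(\<forall>(u, v)\<in>cycle_edges C. P u v) \<longleftrightarrow>
      (\<forall>i<length C. P (cycle_nth C i) (cycle_nth C (i + 1)))" for P
    by (auto simp: cycle_edges_conv)
  then show ?thesis by (simp add: prescribed_wind_def)
qed

section \<open>Displacements in a cyclic ordering\<close>

lemma pos_append: "distinct (xs @ a # ys) \<Longrightarrow> pos (xs @ a # ys) a = length xs"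
  using pos_nth[of "xs @ a # ys" "length xs"] by simp

lemma pos_less:
  assumes "distinct vs" "a \<in> set vs"
  shows "pos vs a < length vs" "vs ! pos vs a = a"
  using assms by (metis in_set_conv_nth pos_nth)+

lemma pos_eq_iff: "distinct vs \<Longrightarrow> a \<in> set vs \<Longrightarrow> b \<in> set vs \<Longrightarrow> pos vs a = pos vs b \<longleftrightarrow> a = b"
  by (metis pos_less(2))

text \<open>Up to the coboundary of \<open>pos vs\<close>, the displacement is
  \<open>length vs\<close> times the indicator of passing the point where the circle is cut
  open.\<close>

lemma theta_conv:
  assumes "distinct vs" "a \<in> set vs" "b \<in> set vs"
  shows "theta (cyc vs) a b =
    int (pos vs b) - int (pos vs a) + int (length vs) * of_bool (pos vs b < pos vs a)"
  using assms by (simp add: theta_cyc lin_theta_def Let_def)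

lemma theta_add_swap:
  assumes "cyclic_ordering V \<sigma>" "a \<in> V" "b \<in> V" "a \<noteq> b"
  shows "theta \<sigma> a b + theta \<sigma> b a = int (card V)"
proof -
  from assms obtain vs where vs: "distinct vs" "set vs = V" "\<sigma> = cyc vs"
    by (auto simp: cyclic_ordering_def)
  then have "pos vs a \<noteq> pos vs b" using assms by (simp add: pos_eq_iff)
  then show ?thesis using vs assms distinct_card[of vs] by (simp add: theta_conv)
qed

lemma cyc_rotate [simp]: "cyc (rotate m vs) = cyc vs"
proof -
  have "rotate l vs \<in> cyc (rotate m vs)" for l
  proof -
    \<comment> \<open>A rotation by \<open>m * (length vs - 1)\<close> undoes a rotation by
      \<open>m\<close>: together they make \<open>m\<close> full turns.\<close>
    have "l + m * (length vs - 1) + m = l + m * length vs" if "vs \<noteq> []"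
      using that by (cases vs) auto
    then have "rotate (l + m * (length vs - 1) + m) vs = rotate l vs"
      by (cases "vs = []") (simp, metis mod_mult_self1 rotate_conv_mod)
    then show ?thesis
      unfolding cyc_def rotate_rotate by (metis (mono_tags, lifting) mem_Collect_eq)
  qed
  then show ?thesis by (auto simp: cyc_def rotate_rotate)
qed

lemma self_in_cyc: "vs \<in> cyc vs"
  by (auto simp: cyc_def intro: exI[of _ 0])

lemma cyclic_orderingD:
  assumes "cyclic_ordering V \<sigma>" "vs \<in> \<sigma>"
  shows "distinct vs" "set vs = V" "\<sigma> = cyc vs"
proof -
  obtain ws m where "distinct ws" "set ws = V" "\<sigma> = cyc ws" "vs = rotate m ws"
    using assms by (auto simp: cyclic_ordering_def cyc_def)
  then show "distinct vs" "set vs = V" "\<sigma> = cyc vs" by simp_all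
qed

lemma cyclic_ordering_cyc_iff: "cyclic_ordering V (cyc vs) \<longleftrightarrow> distinct vs \<and> set vs = V"
  using cyclic_orderingD[OF _ self_in_cyc, of V vs] by (auto simp: cyclic_ordering_def)

text \<open>With the circle cut open so that \<open>i\<close>, \<open>j\<close>, \<open>k\<close>
  occur in this order, none of the three displacements passes the cut, and they add like differences
  of positions.\<close>

lemma theta_right_turn:
  assumes "cyclic_ordering V \<sigma>" "right_turn \<sigma> i j k"
  shows "theta \<sigma> i j + theta \<sigma> j k = theta \<sigma> i k"
proof -
  from assms obtain ws xs ys zs where 1: "ws @ [i] @ xs @ [j] @ ys @ [k] @ zs \<in> \<sigma>" (is "?L \<in> _")
    by (auto simp: right_turn_def)
  note L = cyclic_orderingD[OF assms(1) 1]
  have "pos ?L i = length ws" "pos ?L j = length (ws @ [i] @ xs)"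
    "pos ?L k = length (ws @ [i] @ xs @ [j] @ ys)"
    using L(1) pos_append[of ws i] pos_append[of "ws @ [i] @ xs" j]
      pos_append[of "ws @ [i] @ xs @ [j] @ ys" k] by simp_all
  moreover have "i \<in> set ?L" "j \<in> set ?L" "k \<in> set ?L" by simp_all
  ultimately show ?thesis unfolding L(3) using L(1) by (simp only: theta_conv) simp
qed

lemma affine_combine:
  fixes t :: int
  assumes "t = p - q + N * b" "t' = p' - q' + N * b'" "b' = b + (c - d)"
  shows "t' = t + ((p' - p) - (q' - q)) + N * (c - d)"
  unfolding assms by (simp add: algebra_simps)

text \<open>The function \<open>g\<close> is the change of position. Only pairs formed by
  \<open>j\<close> and an element of \<open>xs\<close> change their order in the list, and for these
  the indicator of passing the cut changes by one.\<close>

lemma theta_move: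
  assumes "distinct (j # xs @ ys)"
  obtains g where "\<And>u v. u \<in> set (j # xs @ ys) \<Longrightarrow> v \<in> set (j # xs @ ys) \<Longrightarrow> u \<noteq> v \<Longrightarrow>
    theta (cyc (xs @ j # ys)) u v = theta (cyc (j # xs @ ys)) u v + (g v - g u) +
      int (length (j # xs @ ys)) * (of_bool (u = j \<and> v \<in> set xs) - of_bool (v = j \<and> u \<in> set xs))"
proof
  let ?v = "j # xs @ ys" and ?w = "xs @ j # ys"
  have dw: "distinct ?w" using assms by auto
  have pj: "pos ?v j = 0" "pos ?w j = length xs"
    using pos_append[of "[]" j] pos_append[OF dw] assms by auto
  have px: "pos ?v x = Suc (pos ?w x) \<and> pos ?w x < length xs" if "x \<in> set xs" for x
  proof -
    from that obtain as bs where xs: "xs = as @ x # bs" by (auto simp: in_set_conv_decomp)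
    show ?thesis using assms dw pos_append[of "j # as" x "bs @ ys"] pos_append[of as x "bs @ j # ys"]
      unfolding xs by simp
  qed
  have py: "pos ?v y = pos ?w y \<and> pos ?w y > length xs" if "y \<in> set ys" for y
  proof -
    from that obtain as bs where ys: "ys = as @ y # bs" by (auto simp: in_set_conv_decomp)
    show ?thesis using assms dw pos_append[of "j # xs @ as" y bs] pos_append[of "xs @ j # as" y bs]
      unfolding ys by simp
  qed
  fix u v assume uv: "u \<in> set ?v" "v \<in> set ?v" "u \<noteq> v"
  have ne: "pos ?v u \<noteq> pos ?v v" using uv assms by (simp only: pos_eq_iff not_False_eq_True)
  have "theta (cyc ?v) u v = int (pos ?v v) - int (pos ?v u) + int (length ?v) * of_bool (pos ?v v < pos ?v u)"
    using uv assms by (intro theta_conv) auto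
  moreover have "theta (cyc ?w) u v = int (pos ?w v) - int (pos ?w u) + int (length ?v) * of_bool (pos ?w v < pos ?w u)"
    using theta_conv[OF dw, of u v] uv by auto
  moreover have "(of_bool (pos ?w v < pos ?w u) :: int) = of_bool (pos ?v v < pos ?v u)
     + (of_bool (u = j \<and> v \<in> set xs) - of_bool (v = j \<and> u \<in> set xs))"
  proof -
    have u: "u = j \<and> u \<notin> set xs \<or> u \<noteq> j \<and> u \<in> set xs \<or> u \<noteq> j \<and> u \<notin> set xs \<and> u \<in> set ys"
      and v: "v = j \<and> v \<notin> set xs \<or> v \<noteq> j \<and> v \<in> set xs \<or> v \<noteq> j \<and> v \<notin> set xs \<and> v \<in> set ys"
      using uv assms by auto
    show ?thesis
      using u
    proof (elim disjE conjE)
      assume "u = j" "u \<notin> set xs"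
      then show ?thesis using v px[of v] py[of v] pj uv(3) by (elim disjE conjE) simp_all
    next
      assume "u \<noteq> j" "u \<in> set xs"
      then show ?thesis using v px[of v] py[of v] px[of u] pj by (elim disjE conjE) simp_all
    next
      assume "u \<noteq> j" "u \<notin> set xs" "u \<in> set ys"
      then show ?thesis using v px[of v] py[of v] py[of u] pj by (elim disjE conjE) simp_all
    qed
  qed
  ultimately show "theta (cyc ?w) u v = theta (cyc ?v) u v + ((int (pos ?w v) - int (pos ?v v)) - (int (pos ?w u) - int (pos ?v u))) +
      int (length ?v) * (of_bool (u = j \<and> v \<in> set xs) - of_bool (v = j \<and> u \<in> set xs))"
    by (rule affine_combine)
qed

section \<open>Winding numbers under wiggles and proper mutations\<close>

text \<open>The contribution of an edge to the winding number, multiplied by the number of vertices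
  so as to stay in the integers.\<close>

definition wind_weight :: "'a quiver \<Rightarrow> 'a list set \<Rightarrow> 'a \<Rightarrow> 'a \<Rightarrow> int" where
  "wind_weight Q \<sigma> u v = theta \<sigma> u v - int (card (verts Q)) * of_bool (arr Q v u > 0)"

lemma wind_eq_iff:
  assumes "quiver Q" "chordless_cycle Q C"
  shows "wind Q C \<sigma> = of_int m \<longleftrightarrow> cycle_sum (wind_weight Q \<sigma>) C = int (card (verts Q)) * m"
proof -
  let ?n = "card (verts Q)"
  have "?n > 0" using assms
    by (cases C) (auto simp: chordless_cycle_conv quiver_def card_gt_0_iff)
  have l: "of_nat (card {i. i < length C \<and> arr Q (cycle_nth C (i + 1)) (cycle_nth C i) > 0}) =
      (of_int (cycle_sum (\<lambda>u v. of_bool (arr Q v u > 0)) C) :: rat)"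
  proof -
    have "{i. i < length C \<and> arr Q (cycle_nth C (i + 1)) (cycle_nth C i) > 0} =
        {..<length C} \<inter> {i. arr Q (cycle_nth C (i + 1)) (cycle_nth C i) > 0}"
      by auto
    then show ?thesis
      by (simp only: cycle_sum_conv sum_of_bool_eq finite_lessThan of_int_of_nat_eq)
  qed
  have "cycle_sum (wind_weight Q \<sigma>) C =
      cycle_sum (theta \<sigma>) C - int ?n * cycle_sum (\<lambda>u v. of_bool (arr Q v u > 0)) C"
    unfolding wind_weight_def by (simp add: cycle_sum_diff cycle_sum_mult)
  then have "(of_int (cycle_sum (wind_weight Q \<sigma>) C) :: rat) = of_int (cycle_sum (theta \<sigma>) C)
      - of_nat ?n * of_int (cycle_sum (\<lambda>u v. of_bool (arr Q v u > 0)) C)"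
    by simp
  then have "wind Q C \<sigma> = of_int (cycle_sum (wind_weight Q \<sigma>) C) / of_nat ?n"
    unfolding wind_def l cycle_sum_conv[symmetric] using \<open>?n > 0\<close> by (simp add: field_simps)
  also have "\<dots> = of_int m \<longleftrightarrow> (of_int (cycle_sum (wind_weight Q \<sigma>) C) :: rat) = of_int (int ?n * m)"
    using \<open>?n > 0\<close> by (simp add: field_simps)
  finally show ?thesis by (simp only: of_int_eq_iff)
qed

lemma wiggle_sym: "wiggle Q \<sigma> \<sigma>' \<Longrightarrow> wiggle Q \<sigma>' \<sigma>"
  by (force simp: wiggle_def adjacent_sym)

text \<open>A wiggle moves \<open>a\<close> past the single vertex \<open>b\<close>. Only the
  displacements between \<open>a\<close> and \<open>b\<close> change by more than a coboundary, and
  no edge joins these two.\<close>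

lemma wiggle_theta:
  assumes "cyclic_ordering V \<sigma>" "wiggle Q \<sigma> \<sigma>'"
  shows "cyclic_ordering V \<sigma>'"
    and "\<exists>g. \<forall>u\<in>V. \<forall>v\<in>V. u \<noteq> v \<and> adjacent Q u v \<longrightarrow> theta \<sigma>' u v = theta \<sigma> u v + (g v - g u)"
proof -
  obtain a b vs where ab: "\<sigma> = cyc (a # b # vs)" "\<sigma>' = cyc (b # a # vs)" "\<not> adjacent Q a b"
    using assms(2) by (auto simp: wiggle_def)
  then have d: "distinct (a # b # vs)" "set (a # b # vs) = V"
    using assms(1) cyclic_ordering_cyc_iff by blast+
  then show "cyclic_ordering V \<sigma>'" unfolding ab cyclic_ordering_cyc_iff by auto
  obtain g where "\<And>u v. u \<in> V \<Longrightarrow> v \<in> V \<Longrightarrow> u \<noteq> v \<Longrightarrow>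
    theta \<sigma>' u v = theta \<sigma> u v + (g v - g u) + int (length (a # b # vs)) *
      (of_bool (u = a \<and> v = b) - of_bool (v = a \<and> u = b))"
    by (rule theta_move[of a "[b]" vs]) (use d ab in auto)
  then show "\<exists>g. \<forall>u\<in>V. \<forall>v\<in>V. u \<noteq> v \<and> adjacent Q u v \<longrightarrow> theta \<sigma>' u v = theta \<sigma> u v + (g v - g u)"
    using ab(3) adjacent_sym by (intro exI[of _ g]) fastforce
qed

lemma wiggle_equivalent_theta:
  assumes "cyclic_ordering V \<sigma>" "wiggle_equivalent Q \<sigma> \<sigma>'"
  shows "cyclic_ordering V \<sigma>' \<and>
    (\<exists>g. \<forall>u\<in>V. \<forall>v\<in>V. u \<noteq> v \<and> adjacent Q u v \<longrightarrow> theta \<sigma>' u v = theta \<sigma> u v + (g v - g u))"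
  using assms(2) unfolding wiggle_equivalent_def
proof (induction rule: equivclp_induct)
  case base
  show ?case using assms(1) by (auto intro: exI[of _ "\<lambda>_. 0"])
next
  case (step \<tau> \<tau>')
  then obtain g where g: "\<forall>u\<in>V. \<forall>v\<in>V. u \<noteq> v \<and> adjacent Q u v \<longrightarrow> theta \<tau> u v = theta \<sigma> u v + (g v - g u)"
    by blast
  have "wiggle Q \<tau> \<tau>'" using step wiggle_sym by blast
  with step obtain h where "cyclic_ordering V \<tau>'"
    and h: "\<forall>u\<in>V. \<forall>v\<in>V. u \<noteq> v \<and> adjacent Q u v \<longrightarrow> theta \<tau>' u v = theta \<tau> u v + (h v - h u)"
    using wiggle_theta by metis
  then show ?case using g by (intro conjI exI[of _ "\<lambda>u. g u + h u"]) auto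
qed

section \<open>The effect of a proper mutation on displacements\<close>

lemma wiggle_equivalent_in_class:
  assumes "wiggle_equivalent R \<tau> \<tau>'" "in_proper_mutation_class Q \<sigma> R \<tau>"
  shows "in_proper_mutation_class Q \<sigma> R \<tau>'"
  using assms unfolding wiggle_equivalent_def
  by (induction rule: equivclp_induct) (auto intro: in_proper_mutation_class.wiggle wiggle_sym)

lemma in_proper_mutation_class_trans:
  assumes "in_proper_mutation_class R \<tau> S \<rho>" "in_proper_mutation_class Q \<sigma> R \<tau>"
  shows "in_proper_mutation_class Q \<sigma> S \<rho>"
  using assms by (induction rule: in_proper_mutation_class.induct)
    (auto intro: in_proper_mutation_class.intros)

text \<open>Since there is no loop at \<open>j\<close>, composing paths leaves the arrows at
  \<open>j\<close> alone, and since there are no 2-cycles at \<open>j\<close>, cancellation does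
  too; so these arrows are merely reversed.\<close>

lemma arr_mutate:
  assumes "quiver Q"
  shows "arr (mutate j Q) a b = (if a = j \<or> b = j then arr Q b a
    else (arr Q a b + arr Q a j * arr Q j b) - (arr Q b a + arr Q b j * arr Q j a))"
proof -
  have "arr Q j j = 0" "arr Q j a = 0 \<or> arr Q a j = 0" "arr Q j b = 0 \<or> arr Q b j = 0"
    using assms by (auto simp: quiver_def)
  then show ?thesis
    unfolding mutate_def cancel_two_cycles_def reverse_at_def compose_paths_def
    by (cases "a = j"; cases "b = j"; elim disjE; simp)
qed

text \<open>The invariant of the descent: a suitable proper mutation at any vertex leads to such a
  pair again.\<close>

definition totally_proper_coq :: "'a quiver \<Rightarrow> 'a list set \<Rightarrow> bool" where
  "totally_proper_coq Q \<sigma> \<longleftrightarrow> quiver Q \<and> cyclic_ordering (verts Q) \<sigma> \<and> totally_proper Q \<sigma>"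

text \<open>Going clockwise from a proper vertex \<open>j\<close>, one meets all out-neighbours
  before the first in-neighbour, so \<open>xs\<close> can be the longest initial segment free of
  in-neighbours.\<close>

lemma proper_vertex_splits:
  assumes "quiver Q" "cyclic_ordering (verts Q) \<sigma>" "proper_vertex Q \<sigma> j" "j \<in> verts Q"
  obtains xs ys where "\<sigma> = cyc (j # xs @ ys)" "out_nbrs Q j \<subseteq> set xs" "set xs \<inter> in_nbrs Q j = {}"
proof -
  obtain vs where vs: "distinct vs" "set vs = verts Q" "\<sigma> = cyc vs"
    using assms(2) by (auto simp: cyclic_ordering_def)
  obtain as bs where ab: "vs = as @ j # bs" using vs(2) assms(4) by (metis split_list)
  define zs where "zs = bs @ as"
  have "rotate (length as) vs = j # zs" unfolding ab zs_def by (simp add: rotate_append)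
  then have s: "\<sigma> = cyc (j # zs)" using vs(3) cyc_rotate by metis
  then have z: "distinct (j # zs)" "insert j (set zs) = verts Q"
    using assms(2) cyclic_ordering_cyc_iff[of "verts Q" "j # zs"] by auto
  define xs where "xs = takeWhile (\<lambda>x. x \<notin> in_nbrs Q j) zs"
  have "out_nbrs Q j \<subseteq> set xs"
  proof
    fix k assume k: "k \<in> out_nbrs Q j"
    then have "k \<in> set zs" using assms(1) z(2) adjacent_in_verts[of Q j k]
      by (auto simp: out_nbrs_def adjacent_def)
    show "k \<in> set xs"
    proof (rule ccontr)
      assume "k \<notin> set xs"
      moreover have "k \<notin> in_nbrs Q j" using k assms(1) by (auto simp: quiver_def in_nbrs_def out_nbrs_def)
      moreover define us where "us = dropWhile (\<lambda>x. x \<notin> in_nbrs Q j) zs"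
      have us: "zs = xs @ us" unfolding xs_def us_def by simp
      ultimately have "k \<in> set us" using \<open>k \<in> set zs\<close> by auto
      then obtain i us' where i: "us = i # us'" by (cases us) auto
      then have "i \<in> in_nbrs Q j"
        using hd_dropWhile[of "\<lambda>x. x \<notin> in_nbrs Q j" zs] unfolding us_def by auto
      then have "arr Q i j > 0" "arr Q j k > 0" using k by (auto simp: in_nbrs_def out_nbrs_def)
      moreover have "i \<noteq> k" using \<open>i \<in> in_nbrs Q j\<close> \<open>k \<notin> in_nbrs Q j\<close> by auto
      then obtain us1 us2 where k: "us' = us1 @ k # us2" using \<open>k \<in> set us\<close> i by (auto dest: split_list)
      have "right_turn \<sigma> i j k" using assms(3) \<open>arr Q i j > 0\<close> \<open>arr Q j k > 0\<close> by (auto simp: proper_vertex_def)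
      then have "theta \<sigma> i j + theta \<sigma> j k = theta \<sigma> i k" using theta_right_turn assms(2) by metis
      moreover have zs: "zs = xs @ i # us1 @ k # us2" using us i k by simp
      have "right_turn \<sigma> j i k" unfolding right_turn_def s zs
        by (rule exI[of _ "[]"], rule exI[of _ xs], rule exI[of _ us1], rule exI[of _ us2]) (simp add: self_in_cyc)
      then have "theta \<sigma> j i + theta \<sigma> i k = theta \<sigma> j k" using theta_right_turn assms(2) by metis
      moreover have "theta \<sigma> i j + theta \<sigma> j i = int (card (verts Q))"
        using theta_add_swap[OF assms(2), of i j] z zs by auto
      moreover have "card (verts Q) > 0" using assms(1,4) by (auto simp: quiver_def card_gt_0_iff)
      \<comment> \<open>The two right-turn identities add up to
        \<open>theta \<sigma> i j + theta \<sigma> j i = 0\<close>, but this sum is the positive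
        number of vertices.\<close>
      ultimately show False by linarith
    qed
  qed
  moreover have "set xs \<inter> in_nbrs Q j = {}" unfolding xs_def by (auto dest: set_takeWhileD)
  moreover have "\<sigma> = cyc (j # xs @ dropWhile (\<lambda>x. x \<notin> in_nbrs Q j) zs)" unfolding xs_def s by simp
  ultimately show ?thesis using that by blast
qed

text \<open>Wiggles first make \<open>j\<close> proper in \<open>\<sigma>\<^sub>1\<close>, then
  \<open>j\<close> moves past the set \<open>X\<close>. The first change is controlled on edges of
  \<open>Q\<close> only, the second on all pairs of distinct vertices, because mutation may create
  edges that \<open>Q\<close> lacks.\<close>

lemma proper_mutation:
  assumes "totally_proper_coq Q \<sigma>" "j \<in> verts Q"
  obtains \<sigma>\<^sub>1 \<sigma>' g X g' where
    "cyclic_ordering (verts Q) \<sigma>\<^sub>1" "proper_vertex Q \<sigma>\<^sub>1 j" "totally_proper_coq (mutate j Q) \<sigma>'"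
    "\<forall>u v. adjacent Q u v \<longrightarrow> theta \<sigma>\<^sub>1 u v = theta \<sigma> u v + (g v - g u)"
    "out_nbrs Q j \<subseteq> X" "X \<inter> in_nbrs Q j = {}"
    "\<forall>u\<in>verts Q. \<forall>v\<in>verts Q. u \<noteq> v \<longrightarrow>
      theta \<sigma>' u v = theta \<sigma>\<^sub>1 u v + (g' v - g' u) +
        int (card (verts Q)) * (of_bool (u = j \<and> v \<in> X) - of_bool (v = j \<and> u \<in> X))"
proof -
  have Q: "quiver Q" "cyclic_ordering (verts Q) \<sigma>" and tp: "totally_proper Q \<sigma>"
    using assms by (auto simp: totally_proper_coq_def)
  then have "proper Q \<sigma>" using in_proper_mutation_class.refl unfolding totally_proper_def by blast
  then obtain \<sigma>\<^sub>1 where s1: "wiggle_equivalent Q \<sigma> \<sigma>\<^sub>1" "proper_vertex Q \<sigma>\<^sub>1 j"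
    using assms(2) by (auto simp: proper_def)
  from wiggle_equivalent_theta[OF Q(2) s1(1)] obtain g where co: "cyclic_ordering (verts Q) \<sigma>\<^sub>1"
    and g: "\<forall>u\<in>verts Q. \<forall>v\<in>verts Q. u \<noteq> v \<and> adjacent Q u v \<longrightarrow> theta \<sigma>\<^sub>1 u v = theta \<sigma> u v + (g v - g u)"
    by blast
  obtain xs ys where xs: "\<sigma>\<^sub>1 = cyc (j # xs @ ys)" "out_nbrs Q j \<subseteq> set xs" "set xs \<inter> in_nbrs Q j = {}"
    using proper_vertex_splits[OF Q(1) co s1(2) assms(2)] .
  have d: "distinct (j # xs @ ys)" "set (j # xs @ ys) = verts Q"
    using co unfolding xs cyclic_ordering_cyc_iff by auto
  let ?s = "cyc (xs @ j # ys)"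
  have "in_proper_mutation_class Q \<sigma> (mutate j Q) ?s"
  proof (rule in_proper_mutation_class.mutation)
    show "in_proper_mutation_class Q \<sigma> Q \<sigma>\<^sub>1"
      using wiggle_equivalent_in_class[OF s1(1)] in_proper_mutation_class.refl by blast
    show "moved_past_out Q j \<sigma>\<^sub>1 ?s" using xs unfolding moved_past_out_def by blast
  qed (use assms s1 in auto)
  then have "totally_proper (mutate j Q) ?s"
    using tp in_proper_mutation_class_trans unfolding totally_proper_def by blast
  moreover have "cyclic_ordering (verts Q) ?s" unfolding cyclic_ordering_cyc_iff using d by auto
  ultimately have tp': "totally_proper_coq (mutate j Q) ?s" using Q by (simp add: totally_proper_coq_def quiver_mutate)
  obtain g' where g': "\<And>u v. u \<in> set (j # xs @ ys) \<Longrightarrow> v \<in> set (j # xs @ ys) \<Longrightarrow> u \<noteq> v \<Longrightarrow>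
    theta ?s u v = theta \<sigma>\<^sub>1 u v + (g' v - g' u) +
      int (length (j # xs @ ys)) * (of_bool (u = j \<and> v \<in> set xs) - of_bool (v = j \<and> u \<in> set xs))"
    using theta_move[OF d(1)] unfolding xs(1) by blast
  have len: "length (j # xs @ ys) = card (verts Q)" using distinct_card[OF d(1)] d(2) by simp
  show ?thesis
  proof (rule that[where g = g and g' = g', OF co s1(2) tp' _ xs(2,3)])
    show "\<forall>u v. adjacent Q u v \<longrightarrow> theta \<sigma>\<^sub>1 u v = theta \<sigma> u v + (g v - g u)"
      using g adjacent_in_verts[OF Q(1)] by blast
  qed (use g'[unfolded d(2) len] in auto)
qed

section \<open>Mutation at a vertex of a chordless cycle\<close>

lemma chordless_cycle_adjacent_iff:
  assumes "chordless_cycle Q C" "u \<in> set C" "v \<in> set C"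
  shows "adjacent Q u v \<longleftrightarrow> (u, v) \<in> cycle_edges C \<or> (v, u) \<in> cycle_edges C"
  using assms unfolding chordless_cycle_conv by blast

lemma chordless_cycle_neighbours:
  assumes "chordless_cycle Q (i # j # k # r)"
  shows "\<And>u. u \<in> set (i # j # k # r) \<Longrightarrow> adjacent Q j u \<Longrightarrow> u = i \<or> u = k"
    and "r \<noteq> [] \<Longrightarrow> \<not> adjacent Q i k"
proof -
  have d: "distinct (i # j # k # r)" using assms by (simp add: chordless_cycle_conv)
  have R: "(u, v) \<in> set (zip (k # r) (r @ [i])) \<Longrightarrow> u \<in> insert k (set r) \<and> v \<in> insert i (set r)" for u v
    by (auto dest: set_zip_leftD set_zip_rightD)
  have E: "cycle_edges (i # j # k # r) = {(i, j), (j, k)} \<union> set (zip (k # r) (r @ [i]))"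
    by (auto simp: cycle_edges_def)
  show "u = i \<or> u = k" if "u \<in> set (i # j # k # r)" "adjacent Q j u" for u
  proof -
    have "(j, u) \<in> cycle_edges (i # j # k # r) \<or> (u, j) \<in> cycle_edges (i # j # k # r)"
      using chordless_cycle_adjacent_iff[OF assms _ that(1), of j] that(2) by simp
    then show ?thesis using d R[of j u] R[of u j] unfolding E by auto
  qed
  show "\<not> adjacent Q i k" if "r \<noteq> []"
  proof
    assume "adjacent Q i k"
    then have "(i, k) \<in> cycle_edges (i # j # k # r) \<or> (k, i) \<in> cycle_edges (i # j # k # r)"
      using chordless_cycle_adjacent_iff[OF assms, of i k] by simp
    then have "(k, i) \<in> set (zip (k # r) (r @ [i]))" using d R[of i k] unfolding E by auto
    \<comment> \<open>The successor of \<open>k\<close> in the cycle is \<open>l\<close>, which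
      differs from \<open>i\<close>.\<close>
    moreover obtain l r' where "r = l # r'" using \<open>r \<noteq> []\<close> by (cases r) auto
    ultimately show False using d by (auto dest: set_zip_leftD)
  qed
qed

text \<open>Mutation at \<open>j\<close> replaces \<open>i \<rightarrow> j \<rightarrow> k\<close>
  by arrows \<open>i \<rightarrow> k\<close>. These agree with the traversal, as the old ones did,
  so whether the cycle is oriented does not change.\<close>

lemma shortcut:
  assumes tp: "totally_proper_coq Q \<sigma>" and C: "chordless_cycle Q (i # j # k # r)" and "r \<noteq> []"
    and ij: "arr Q i j > 0" and jk: "arr Q j k > 0"
  obtains Q' \<sigma>' where "totally_proper_coq Q' \<sigma>'" "verts Q' = verts Q" "chordless_cycle Q' (i # k # r)"
    "cycle_sum (wind_weight Q' \<sigma>') (i # k # r) = cycle_sum (wind_weight Q \<sigma>) (i # j # k # r)"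
    "prescribed_wind Q' (i # k # r) = prescribed_wind Q (i # j # k # r)"
proof -
  let ?C = "i # j # k # r" and ?C' = "i # k # r" and ?Q = "mutate j Q" and ?n = "int (card (verts Q))"
  let ?R = "set (zip (k # r) (r @ [i]))"
  have Q: "quiver Q" using tp by (simp add: totally_proper_coq_def)
  have no2: "arr Q u v = 0 \<or> arr Q v u = 0" for u v using Q by (auto simp: quiver_def)
  have d: "distinct ?C" and V: "set ?C \<subseteq> verts Q" using C by (auto simp: chordless_cycle_conv)
  have jV: "j \<in> verts Q" using V by simp
  obtain \<sigma>\<^sub>1 \<sigma>' g X g' where m:
    "cyclic_ordering (verts Q) \<sigma>\<^sub>1" "proper_vertex Q \<sigma>\<^sub>1 j" "totally_proper_coq ?Q \<sigma>'"
    "\<forall>u v. adjacent Q u v \<longrightarrow> theta \<sigma>\<^sub>1 u v = theta \<sigma> u v + (g v - g u)"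
    "out_nbrs Q j \<subseteq> X" "X \<inter> in_nbrs Q j = {}"
    "\<forall>u\<in>verts Q. \<forall>v\<in>verts Q. u \<noteq> v \<longrightarrow>
      theta \<sigma>' u v = theta \<sigma>\<^sub>1 u v + (g' v - g' u) +
        ?n * (of_bool (u = j \<and> v \<in> X) - of_bool (v = j \<and> u \<in> X))"
    by (rule proper_mutation[OF tp jV])
  have nik: "\<not> adjacent Q i k" using chordless_cycle_neighbours[OF C] \<open>r \<noteq> []\<close> by blast
  have nb: "u = i \<or> u = k" if "u \<in> set ?C" "adjacent Q j u" for u
    using chordless_cycle_neighbours[OF C] that by blast
  have E: "cycle_edges ?C = {(i, j), (j, k)} \<union> ?R" and E': "cycle_edges ?C' = insert (i, k) ?R"
    by (auto simp: cycle_edges_def)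
  have R: "u \<in> insert k (set r) \<and> v \<in> insert i (set r)" if "(u, v) \<in> ?R" for u v
    using that by (auto dest: set_zip_leftD set_zip_rightD)
  have ji: "arr Q j i = 0" "arr Q k j = 0" "arr Q i k = 0" "arr Q k i = 0"
    using no2[of i j] no2[of j k] ij jk nik by (auto simp: adjacent_def)
  have arr: "arr ?Q u v = (if u = i \<and> v = k then arr Q i j * arr Q j k else arr Q u v)"
    if uv: "u \<in> set ?C'" "v \<in> set ?C'" for u v
  proof -
    have "u \<noteq> j" "v \<noteq> j" using uv d by auto
    \<comment> \<open>By chordlessness, the only two-arrow path through \<open>j\<close> between
      vertices of the shorter cycle is \<open>i \<rightarrow> j \<rightarrow> k\<close>.\<close>
    have p: "arr Q x j * arr Q j y = (if x = i \<and> y = k then arr Q i j * arr Q j k else 0)"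
      if "x \<in> set ?C'" "y \<in> set ?C'" for x y
    proof (cases "arr Q x j > 0 \<and> arr Q j y > 0")
      case True
      then have "x = i \<or> x = k" "y = i \<or> y = k" using nb[of x] nb[of y] that by (auto simp: adjacent_def)
      then show ?thesis using True ji by auto
    qed (use ij jk in auto)
    have "i \<noteq> k" using d by simp
    show ?thesis
      unfolding arr_mutate[OF Q] p[OF uv] p[OF uv(2,1)]
      using \<open>u \<noteq> j\<close> \<open>v \<noteq> j\<close> \<open>i \<noteq> k\<close> ji no2[of u v]
      by (cases "u = i \<and> v = k"; cases "v = i \<and> u = k") auto
  qed
  have C': "chordless_cycle ?Q ?C'"
    unfolding chordless_cycle_conv
  proof (intro conjI ballI)
    fix u v assume uv: "u \<in> set ?C'" "v \<in> set ?C'"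
    have "adjacent Q u v \<longleftrightarrow> (u, v) \<in> cycle_edges ?C \<or> (v, u) \<in> cycle_edges ?C"
      by (rule chordless_cycle_adjacent_iff[OF C]) (use uv in auto)
    also have "\<dots> \<longleftrightarrow> (u, v) \<in> ?R \<or> (v, u) \<in> ?R" using uv d unfolding E by auto
    finally show "adjacent ?Q u v \<longleftrightarrow> (u, v) \<in> cycle_edges ?C' \<or> (v, u) \<in> cycle_edges ?C'"
      unfolding E' using arr[OF uv] arr[OF uv(2,1)] ij jk by (auto simp: adjacent_def)
  qed (use d V \<open>r \<noteq> []\<close> in \<open>auto simp: Suc_le_eq\<close>)
  have wR: "wind_weight ?Q \<sigma>' u v = wind_weight Q \<sigma> u v + ((g v + g' v) - (g u + g' u))" if uv: "(u, v) \<in> ?R" for u v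
  proof -
    have adj: "adjacent Q u v" using cycle_edges_adjacent[OF C] uv unfolding E by auto
    then have "u \<in> verts Q" "v \<in> verts Q" "u \<noteq> v" using adjacent_in_verts[OF Q] by blast+
    moreover have "u \<noteq> j" "v \<noteq> j" "u \<in> set ?C'" "v \<in> set ?C'" using R[OF uv] d by auto
    moreover have "\<not> (v = i \<and> u = k)" using adj nik adjacent_sym by metis
    ultimately show ?thesis
      unfolding wind_weight_def using m(4)[rule_format, OF adj] m(7)[rule_format, of u v] arr[of v u] by auto
  qed
  have ikR: "(i, k) \<notin> ?R" using R[of i k] d by auto
  \<comment> \<open>Properness of \<open>j\<close> makes the displacements along the path add up to
    that of the new edge. No arrow involved opposes the traversal, so the weights add as
    well.\<close>
  have "right_turn \<sigma>\<^sub>1 i j k" using m(2) ij jk by (auto simp: proper_vertex_def)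
  then have "theta \<sigma>\<^sub>1 i j + theta \<sigma>\<^sub>1 j k = theta \<sigma>\<^sub>1 i k" using theta_right_turn m(1) by metis
  moreover have "theta \<sigma>\<^sub>1 i j = theta \<sigma> i j + (g j - g i)" "theta \<sigma>\<^sub>1 j k = theta \<sigma> j k + (g k - g j)"
    using m(4) ij jk by (auto simp: adjacent_def)
  moreover have "theta \<sigma>' i k = theta \<sigma>\<^sub>1 i k + (g' k - g' i)"
    using m(7)[rule_format, of i k] V d by auto
  moreover have "arr ?Q k i = 0" using arr[of k i] d ji by auto
  ultimately have wik: "wind_weight ?Q \<sigma>' i k =
      wind_weight Q \<sigma> i j + wind_weight Q \<sigma> j k + ((g k + g' k) - (g i + g' i))"
    unfolding wind_weight_def using ji by simp
  \<comment> \<open>On the shorter cycle the new weight is the old one, with the two old weights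
    merged on the edge from \<open>i\<close> to \<open>k\<close>, plus the coboundary of
    \<open>g + g'\<close>.\<close>
  have "cycle_sum (wind_weight ?Q \<sigma>') ?C' = cycle_sum (\<lambda>u v. (if u = i \<and> v = k
      then wind_weight Q \<sigma> i j + wind_weight Q \<sigma> j k else wind_weight Q \<sigma> u v)
      + ((g v + g' v) - (g u + g' u))) ?C'"
    by (rule cycle_sum_cong) (use wik wR ikR in \<open>auto simp: E'\<close>)
  also have "\<dots> = cycle_sum (\<lambda>u v. if u = i \<and> v = k
      then wind_weight Q \<sigma> i j + wind_weight Q \<sigma> j k else wind_weight Q \<sigma> u v) ?C'"
    by (simp only: cycle_sum_add cycle_sum_coboundary)
  also have "\<dots> = cycle_sum (wind_weight Q \<sigma>) ?C"
  proof -
    have "(\<Sum>(u, v)\<leftarrow>zip (k # r) (r @ [i]). if u = i \<and> v = k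
      then wind_weight Q \<sigma> i j + wind_weight Q \<sigma> j k else wind_weight Q \<sigma> u v) =
      (\<Sum>(u, v)\<leftarrow>zip (k # r) (r @ [i]). wind_weight Q \<sigma> u v)"
      using ikR by (intro arg_cong[where f = sum_list] map_cong) auto
    then show ?thesis by (simp only: cycle_sum_Cons3 cycle_sum_Cons2) simp
  qed
  finally have w: "cycle_sum (wind_weight ?Q \<sigma>') ?C' = cycle_sum (wind_weight Q \<sigma>) ?C" .
  have arrR: "arr ?Q u v = arr Q u v \<and> arr ?Q v u = arr Q v u" if uv: "(u, v) \<in> ?R" for u v
  proof -
    have adj: "adjacent Q u v" using cycle_edges_adjacent[OF C] uv unfolding E by auto
    moreover have "u \<in> set ?C'" "v \<in> set ?C'" using R[OF uv] by auto
    ultimately show ?thesis using arr[of u v] arr[of v u] nik adjacent_sym by metis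
  qed
  have "arr ?Q i k > 0" using arr[of i k] ij jk by simp
  have "prescribed_wind ?Q ?C' = prescribed_wind Q ?C"
  proof -
    have "(\<forall>(u, v)\<in>cycle_edges ?C'. arr ?Q u v > 0) \<longleftrightarrow> (\<forall>(u, v)\<in>cycle_edges ?C. arr Q u v > 0)"
      unfolding E E' using arrR \<open>arr ?Q i k > 0\<close> ij jk by auto
    moreover have "\<not> (\<forall>(u, v)\<in>cycle_edges ?C'. arr ?Q v u > 0)"
      unfolding E' using \<open>arr ?Q k i = 0\<close> by auto
    moreover have "\<not> (\<forall>(u, v)\<in>cycle_edges ?C. arr Q v u > 0)"
      unfolding E using ji by auto
    ultimately show ?thesis unfolding prescribed_wind_conv by presburger
  qed
  then show ?thesis using that[OF m(3) _ C' w] by simp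
qed

text \<open>At a source or sink of the cycle, mutation creates no arrow between vertices of the
  cycle, so \<open>C\<close> stays chordless. The arrow counts are returned as well, for they decide
  whether the mutated cycle passes straight through \<open>k\<close>.\<close>

lemma flip:
  assumes tp: "totally_proper_coq Q \<sigma>" and C: "chordless_cycle Q (i # j # k # r)" and "r \<noteq> []"
    and src: "arr Q j i > 0 \<and> arr Q j k > 0 \<or> arr Q i j > 0 \<and> arr Q k j > 0"
  obtains Q' \<sigma>' where "totally_proper_coq Q' \<sigma>'" "verts Q' = verts Q" "chordless_cycle Q' (i # j # k # r)"
    "cycle_sum (wind_weight Q' \<sigma>') (i # j # k # r) = cycle_sum (wind_weight Q \<sigma>) (i # j # k # r)"
    "arr Q' j i = arr Q i j" "arr Q' i j = arr Q j i" "arr Q' j k = arr Q k j" "arr Q' k j = arr Q j k"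
    "\<And>u v. (u, v) \<in> set (zip (k # r) (r @ [i])) \<Longrightarrow> arr Q' u v = arr Q u v \<and> arr Q' v u = arr Q v u"
proof -
  let ?C = "i # j # k # r" and ?Q = "mutate j Q" and ?n = "int (card (verts Q))"
  let ?R = "set (zip (k # r) (r @ [i]))"
  have Q: "quiver Q" using tp by (simp add: totally_proper_coq_def)
  have no2: "arr Q u v = 0 \<or> arr Q v u = 0" for u v using Q by (auto simp: quiver_def)
  have d: "distinct ?C" and V: "set ?C \<subseteq> verts Q" using C by (auto simp: chordless_cycle_conv)
  have jV: "j \<in> verts Q" using V by simp
  obtain \<sigma>\<^sub>1 \<sigma>' g X g' where m:
    "cyclic_ordering (verts Q) \<sigma>\<^sub>1" "proper_vertex Q \<sigma>\<^sub>1 j" "totally_proper_coq ?Q \<sigma>'"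
    "\<forall>u v. adjacent Q u v \<longrightarrow> theta \<sigma>\<^sub>1 u v = theta \<sigma> u v + (g v - g u)"
    "out_nbrs Q j \<subseteq> X" "X \<inter> in_nbrs Q j = {}"
    "\<forall>u\<in>verts Q. \<forall>v\<in>verts Q. u \<noteq> v \<longrightarrow>
      theta \<sigma>' u v = theta \<sigma>\<^sub>1 u v + (g' v - g' u) +
        ?n * (of_bool (u = j \<and> v \<in> X) - of_bool (v = j \<and> u \<in> X))"
    by (rule proper_mutation[OF tp jV])
  have nb: "u = i \<or> u = k" if "u \<in> set ?C" "adjacent Q j u" for u
    using chordless_cycle_neighbours[OF C] that by blast
  have E: "cycle_edges ?C = {(i, j), (j, k)} \<union> ?R"
    by (auto simp: cycle_edges_def)
  have R: "u \<in> insert k (set r) \<and> v \<in> insert i (set r)" if "(u, v) \<in> ?R" for u v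
    using that by (auto dest: set_zip_leftD set_zip_rightD)
  have arrj: "arr ?Q j u = arr Q u j" "arr ?Q u j = arr Q j u" for u
    by (simp_all add: arr_mutate[OF Q])
  have arr: "arr ?Q u v = arr Q u v" if uv: "u \<in> set ?C" "v \<in> set ?C" "u \<noteq> j" "v \<noteq> j" for u v
  proof -
    have p: "arr Q x j * arr Q j y = 0" if "x \<in> set ?C" "y \<in> set ?C" for x y
    proof (rule ccontr)
      assume *: "arr Q x j * arr Q j y \<noteq> 0"
      then have "x = i \<or> x = k" "y = i \<or> y = k" using nb[of x] nb[of y] that by (auto simp: adjacent_def)
      then show False using * src no2[of i j] no2[of j k] by auto
    qed
    show ?thesis
      unfolding arr_mutate[OF Q] p[OF uv(1,2)] p[OF uv(2,1)] using uv(3,4) no2[of u v] by auto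
  qed
  have C': "chordless_cycle ?Q ?C"
    unfolding chordless_cycle_conv
  proof (intro conjI ballI)
    fix u v assume uv: "u \<in> set ?C" "v \<in> set ?C"
    have "adjacent ?Q u v \<longleftrightarrow> adjacent Q u v"
      using arrj[of u] arrj[of v] arr[OF uv] arr[OF uv(2,1)] unfolding adjacent_def
      by (cases "u = j"; cases "v = j") auto
    also have "\<dots> \<longleftrightarrow> (u, v) \<in> cycle_edges ?C \<or> (v, u) \<in> cycle_edges ?C"
      by (rule chordless_cycle_adjacent_iff[OF C uv])
    finally show "adjacent ?Q u v \<longleftrightarrow> (u, v) \<in> cycle_edges ?C \<or> (v, u) \<in> cycle_edges ?C" .
  qed (use d V in auto)
  let ?h = "\<lambda>u. g u + g' u"
  have th: "theta \<sigma>' u v = theta \<sigma> u v + (?h v - ?h u) +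
        ?n * (of_bool (u = j \<and> v \<in> X) - of_bool (v = j \<and> u \<in> X))" if "(u, v) \<in> cycle_edges ?C" for u v
  proof -
    have adj: "adjacent Q u v" using cycle_edges_adjacent[OF C] that by auto
    then have "u \<in> verts Q" "v \<in> verts Q" "u \<noteq> v" using adjacent_in_verts[OF Q] by blast+
    then show ?thesis using m(4)[rule_format, OF adj] m(7)[rule_format, of u v] by simp
  qed
  have arrR: "arr ?Q u v = arr Q u v \<and> arr ?Q v u = arr Q v u" if uv: "(u, v) \<in> ?R" for u v
  proof -
    have "u \<in> set ?C" "v \<in> set ?C" "u \<noteq> j" "v \<noteq> j" using R[OF uv] d by auto
    then show ?thesis using arr[of u v] arr[of v u] by blast
  qed
  \<comment> \<open>A source \<open>j\<close> passes both its neighbours, gaining and losing a full turn, and a sink passes neither; with the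
    reversed arrows the weights of the two edges at \<open>j\<close> change by opposite amounts \<open>\<plusminus>b\<close>, up to a coboundary.\<close>
  define b where "b = (if arr Q i j > 0 then ?n else 0)"
  have X: "arr Q j u > 0 \<Longrightarrow> u \<in> X" "arr Q u j > 0 \<Longrightarrow> u \<notin> X" for u
    using m(5,6) by (auto simp: out_nbrs_def in_nbrs_def)
  have wR: "wind_weight ?Q \<sigma>' u v = wind_weight Q \<sigma> u v + (?h v - ?h u)" if uv: "(u, v) \<in> ?R" for u v
    using th[of u v] arrR[OF uv] R[OF uv] uv d unfolding E wind_weight_def by auto
  have ij: "wind_weight ?Q \<sigma>' i j = wind_weight Q \<sigma> i j + (?h j - ?h i) - b"
    using th[of i j] arrj[of i] src X[of i] no2[of i j] d unfolding E wind_weight_def b_def by auto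
  have jk: "wind_weight ?Q \<sigma>' j k = wind_weight Q \<sigma> j k + (?h k - ?h j) + b"
    using th[of j k] arrj[of k] src X[of k] no2[of i j] no2[of j k] d unfolding E wind_weight_def b_def by auto
  have "cycle_sum (wind_weight ?Q \<sigma>') ?C = cycle_sum (\<lambda>u v. wind_weight Q \<sigma> u v +
      ((?h v + (if v = j then - b else 0)) - (?h u + (if u = j then - b else 0)))) ?C"
  proof (rule cycle_sum_cong)
    fix u v assume "(u, v) \<in> cycle_edges ?C"
    then show "wind_weight ?Q \<sigma>' u v = wind_weight Q \<sigma> u v +
      ((?h v + (if v = j then - b else 0)) - (?h u + (if u = j then - b else 0)))"
      using ij jk wR[of u v] R[of u v] d unfolding E by auto
  qed
  also have "\<dots> = cycle_sum (wind_weight Q \<sigma>) ?C"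
    by (simp only: cycle_sum_add cycle_sum_coboundary)
  finally have w: "cycle_sum (wind_weight ?Q \<sigma>') ?C = cycle_sum (wind_weight Q \<sigma>) ?C" .
  show ?thesis
    by (rule that[OF m(3) _ C' w]) (use arrj arrR in auto)
qed

text \<open>Properness at \<open>j\<close> alone forces the three displacements to add up to one
  full turn. The arrow between \<open>k\<close> and \<open>i\<close> then decides between winding
  numbers 1 and 0.\<close>

lemma triangle:
  assumes tp: "totally_proper_coq Q \<sigma>" and C: "chordless_cycle Q [i, j, k]"
    and ij: "arr Q i j > 0" and jk: "arr Q j k > 0"
  shows "cycle_sum (wind_weight Q \<sigma>) [i, j, k] = int (card (verts Q)) * prescribed_wind Q [i, j, k]"
proof -
  let ?n = "int (card (verts Q))"
  have Q: "quiver Q" and co: "cyclic_ordering (verts Q) \<sigma>" and "totally_proper Q \<sigma>"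
    using tp by (auto simp: totally_proper_coq_def)
  then have "proper Q \<sigma>" using in_proper_mutation_class.refl unfolding totally_proper_def by blast
  have d: "distinct [i, j, k]" and V: "{i, j, k} \<subseteq> verts Q" using C by (auto simp: chordless_cycle_conv)
  then obtain \<sigma>\<^sub>1 where s1: "wiggle_equivalent Q \<sigma> \<sigma>\<^sub>1" "proper_vertex Q \<sigma>\<^sub>1 j"
    using \<open>proper Q \<sigma>\<close> by (auto simp: proper_def)
  from wiggle_equivalent_theta[OF co s1(1)] obtain g where co1: "cyclic_ordering (verts Q) \<sigma>\<^sub>1"
    and g: "\<forall>u\<in>verts Q. \<forall>v\<in>verts Q. u \<noteq> v \<and> adjacent Q u v \<longrightarrow> theta \<sigma>\<^sub>1 u v = theta \<sigma> u v + (g v - g u)"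
    by blast
  have E: "cycle_edges [i, j, k] = {(i, j), (j, k), (k, i)}" by (auto simp: cycle_edges_def)
  have "adjacent Q k i" by (rule cycle_edges_adjacent[OF C]) (simp add: E)
  then have ki: "arr Q k i > 0 \<and> arr Q i k = 0 \<or> arr Q k i = 0 \<and> arr Q i k > 0"
    using Q by (auto simp: adjacent_def quiver_def)
  have ji: "arr Q j i = 0" "arr Q k j = 0" using ij jk Q by (auto simp: quiver_def)
  have "right_turn \<sigma>\<^sub>1 i j k" using s1(2) ij jk by (auto simp: proper_vertex_def)
  then have "theta \<sigma>\<^sub>1 i j + theta \<sigma>\<^sub>1 j k = theta \<sigma>\<^sub>1 i k" using theta_right_turn co1 by metis
  moreover have "theta \<sigma>\<^sub>1 i k + theta \<sigma>\<^sub>1 k i = ?n" using theta_add_swap[OF co1, of i k] V d by simp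
  moreover have "theta \<sigma>\<^sub>1 i j = theta \<sigma> i j + (g j - g i)" "theta \<sigma>\<^sub>1 j k = theta \<sigma> j k + (g k - g j)"
    "theta \<sigma>\<^sub>1 k i = theta \<sigma> k i + (g i - g k)"
    using g V d ij jk \<open>adjacent Q k i\<close> by (auto simp: adjacent_def)
  ultimately have "theta \<sigma> i j + theta \<sigma> j k + theta \<sigma> k i = ?n" by linarith
  then show ?thesis
    using ki ij jk ji by (auto simp: cycle_sum_def wind_weight_def prescribed_wind_conv E)
qed

section \<open>Descent to triangles\<close>

lemma wind_weight_antisym:
  assumes "totally_proper_coq Q \<sigma>" "adjacent Q u v"
  shows "wind_weight Q \<sigma> v u = - wind_weight Q \<sigma> u v"
proof -
  have Q: "quiver Q" and co: "cyclic_ordering (verts Q) \<sigma>" using assms by (auto simp: totally_proper_coq_def)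
  have "theta \<sigma> u v + theta \<sigma> v u = int (card (verts Q))"
    using theta_add_swap[OF co] adjacent_in_verts[OF Q assms(2)] by blast
  \<comment> \<open>Exactly one of the two directions opposes the arrows, and its correction cancels
    the full turn.\<close>
  moreover have "arr Q u v > 0 \<and> arr Q v u = 0 \<or> arr Q u v = 0 \<and> arr Q v u > 0"
    using assms(2) Q by (auto simp: adjacent_def quiver_def)
  ultimately show ?thesis by (auto simp: wind_weight_def)
qed

definition winds_as_prescribed :: "'a quiver \<Rightarrow> 'a list set \<Rightarrow> 'a list \<Rightarrow> bool" where
  "winds_as_prescribed Q \<sigma> C \<longleftrightarrow>
     cycle_sum (wind_weight Q \<sigma>) C = int (card (verts Q)) * prescribed_wind Q C"

lemma winds_as_prescribed_rotate1: "winds_as_prescribed Q \<sigma> (rotate1 C) \<longleftrightarrow> winds_as_prescribed Q \<sigma> C"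
  by (simp add: winds_as_prescribed_def prescribed_wind_conv)

lemma winds_as_prescribed_reverse:
  assumes tp: "totally_proper_coq Q \<sigma>" and C: "chordless_cycle Q (i # j # k # r)"
    and w: "winds_as_prescribed Q \<sigma> (k # j # i # rev r)"
  shows "winds_as_prescribed Q \<sigma> (i # j # k # r)"
proof -
  let ?C = "i # j # k # r" and ?D = "k # j # i # rev r"
  have "cycle_sum (wind_weight Q \<sigma>) ?D = cycle_sum (\<lambda>u v. wind_weight Q \<sigma> v u) ?C"
    by (rule cycle_sum_reverse)
  also have "\<dots> = cycle_sum (\<lambda>u v. -1 * wind_weight Q \<sigma> u v) ?C"
    using wind_weight_antisym[OF tp] cycle_edges_adjacent[OF C] by (intro cycle_sum_cong) simp
  also have "\<dots> = - cycle_sum (wind_weight Q \<sigma>) ?C" by (subst cycle_sum_mult) simp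
  finally have s: "cycle_sum (wind_weight Q \<sigma>) ?D = - cycle_sum (wind_weight Q \<sigma>) ?C" .
  have no2: "arr Q i j = 0 \<or> arr Q j i = 0" using tp by (auto simp: totally_proper_coq_def quiver_def)
  have "(i, j) \<in> cycle_edges ?C" by (simp add: cycle_edges_def)
  \<comment> \<open>The definition of \<open>prescribed_wind\<close> tests the two orientations in a
    fixed order, so it changes sign under reversal only because they exclude each other.\<close>
  then have "\<not> ((\<forall>(u, v)\<in>cycle_edges ?C. arr Q u v > 0) \<and> (\<forall>(u, v)\<in>cycle_edges ?C. arr Q v u > 0))"
    using no2 by fastforce
  moreover have "(\<forall>(u, v)\<in>(cycle_edges ?C)\<inverse>. P u v) \<longleftrightarrow> (\<forall>(u, v)\<in>cycle_edges ?C. P v u)" for P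
    by auto
  ultimately have "prescribed_wind Q ?D = - prescribed_wind Q ?C"
    unfolding prescribed_wind_conv cycle_edges_reverse by (simp only: split: if_split) linarith
  then show ?thesis using w s by (simp add: winds_as_prescribed_def)
qed

text \<open>Induction on the length, with \<open>Q\<close> and \<open>\<sigma>\<close> arbitrary
  since mutation changes both. A vertex through which the arrows pass straight allows a shortcut or
  finishes a triangle; the remaining work is to produce such a vertex in second place.\<close>

lemma winds_as_prescribed_chordless:
  fixes Q :: "'a quiver"
  assumes "totally_proper_coq Q \<sigma>" "chordless_cycle Q C"
  shows "winds_as_prescribed Q \<sigma> C"
  using assms
proof (induction "length C" arbitrary: Q \<sigma> C rule: less_induct)
  case less
  \<comment> \<open>This is stated for all quivers and all cycles of this length, as it is applied
    to reversed and rotated cycles and to the flipped quiver.\<close>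
  have directed: "winds_as_prescribed Q \<sigma> (i # j # k # r)"
    if tp: "totally_proper_coq Q \<sigma>" and D: "chordless_cycle Q (i # j # k # r)" and l: "Suc (Suc (Suc (length r))) = length C"
      and a: "arr Q i j > 0" "arr Q j k > 0" for Q :: "'a quiver" and \<sigma> i j k r
  proof (cases "r = []")
    case True
    then show ?thesis using triangle[OF tp _ a] D by (simp add: winds_as_prescribed_def)
  next
    case False
    obtain Q' \<sigma>' where 1: "totally_proper_coq Q' \<sigma>'" "verts Q' = verts Q" "chordless_cycle Q' (i # k # r)"
      "cycle_sum (wind_weight Q' \<sigma>') (i # k # r) = cycle_sum (wind_weight Q \<sigma>) (i # j # k # r)"
      "prescribed_wind Q' (i # k # r) = prescribed_wind Q (i # j # k # r)"
      by (rule shortcut[OF tp D False a])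
    have "winds_as_prescribed Q' \<sigma>' (i # k # r)" using less.hyps[OF _ 1(1,3)] l by simp
    then show ?thesis using 1 by (simp add: winds_as_prescribed_def)
  qed
  have passing: "winds_as_prescribed Q \<sigma> (i # j # k # r)"
    if tp: "totally_proper_coq Q \<sigma>" and D: "chordless_cycle Q (i # j # k # r)" and l: "Suc (Suc (Suc (length r))) = length C"
      and a: "arr Q i j > 0 \<and> arr Q j k > 0 \<or> arr Q k j > 0 \<and> arr Q j i > 0" for Q :: "'a quiver" and \<sigma> i j k r
    using a
  proof
    assume "arr Q k j > 0 \<and> arr Q j i > 0"
    then have "winds_as_prescribed Q \<sigma> (k # j # i # rev r)"
      using directed[OF tp chordless_cycle_reverse[OF D]] l by simp
    then show ?thesis by (rule winds_as_prescribed_reverse[OF tp D])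
  qed (use directed[OF tp D l] in blast)
  have "length C \<ge> 3" using less.prems by (simp add: chordless_cycle_conv)
  then obtain i j k r where C: "C = i # j # k # r"
    by (cases C rule: remdups_adj.cases; cases "tl (tl C)") auto
  have Q: "quiver Q" using less.prems by (simp add: totally_proper_coq_def)
  have arrow: "arr Q u v > 0 \<or> arr Q v u > 0" if "(u, v) \<in> cycle_edges C" for u v
    using cycle_edges_adjacent[OF less.prems(2) that] by (simp add: adjacent_def)
  have rot: "chordless_cycle Q (j # k # r @ [i])" using chordless_cycle_rotate1[OF less.prems(2)] C by simp
  show ?case
  proof (cases "arr Q i j > 0 \<and> arr Q j k > 0 \<or> arr Q k j > 0 \<and> arr Q j i > 0")
    case True
    then show ?thesis using passing[OF less.prems(1), of i j k r] less.prems(2) C by simp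
  next
    case False
    have ar: "arr Q i j > 0 \<or> arr Q j i > 0" "arr Q j k > 0 \<or> arr Q k j > 0"
      using arrow by (auto simp: C cycle_edges_def)
    with False have alt: "arr Q j i > 0 \<and> arr Q j k > 0 \<or> arr Q i j > 0 \<and> arr Q k j > 0" by blast
    show ?thesis
    proof (cases r)
      case Nil
      have rot2: "chordless_cycle Q [k, i, j]" using chordless_cycle_rotate1[OF rot] Nil by simp
      have "arr Q k i > 0 \<or> arr Q i k > 0" using arrow Nil by (auto simp: C cycle_edges_def)
      \<comment> \<open>In a triangle with source or sink \<open>j\<close>, the arrows pass straight
        through both \<open>k\<close> and \<open>i\<close> or through one of them, depending on the
        third arrow; one such vertex suffices.\<close>
      then have "winds_as_prescribed Q \<sigma> [j, k, i] \<or> winds_as_prescribed Q \<sigma> [k, i, j]"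
        using alt passing[OF less.prems(1), of j k i "[]"] passing[OF less.prems(1), of k i j "[]"] rot rot2 C Nil
        by auto
      then show ?thesis
        using winds_as_prescribed_rotate1[of Q \<sigma> C] winds_as_prescribed_rotate1[of Q \<sigma> "[j, k, i]"] C Nil by auto
    next
      case (Cons l r')
      have kl: "arr Q k l > 0 \<or> arr Q l k > 0" using arrow Cons by (auto simp: C cycle_edges_def)
      show ?thesis
      proof (cases "arr Q j k > 0 \<and> arr Q k l > 0 \<or> arr Q l k > 0 \<and> arr Q k j > 0")
        case True
        then have "winds_as_prescribed Q \<sigma> (j # k # l # (r' @ [i]))"
          using passing[OF less.prems(1), of j k l "r' @ [i]"] rot C Cons by simp
        then show ?thesis using winds_as_prescribed_rotate1[of Q \<sigma> C] C Cons by simp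
      next
        case False
        \<comment> \<open>Both \<open>j\<close> and \<open>k\<close> are sources or sinks of the
          cycle. Flipping \<open>j\<close> reverses the arrows between \<open>j\<close> and
          \<open>k\<close> but not those between \<open>k\<close> and \<open>l\<close>, so the cycle
          then passes straight through \<open>k\<close>.\<close>
        obtain Q' \<sigma>' where 1: "totally_proper_coq Q' \<sigma>'" "verts Q' = verts Q" "chordless_cycle Q' (i # j # k # r)"
          "cycle_sum (wind_weight Q' \<sigma>') (i # j # k # r) = cycle_sum (wind_weight Q \<sigma>) (i # j # k # r)"
          "arr Q' j i = arr Q i j" "arr Q' i j = arr Q j i" "arr Q' j k = arr Q k j" "arr Q' k j = arr Q j k"
          "\<And>u v. (u, v) \<in> set (zip (k # r) (r @ [i])) \<Longrightarrow> arr Q' u v = arr Q u v \<and> arr Q' v u = arr Q v u"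
          using flip[OF less.prems(1) less.prems(2)[unfolded C] _ alt] Cons by blast
        have "arr Q' k l = arr Q k l" "arr Q' l k = arr Q l k" using 1(9)[of k l] Cons by auto
        then have a: "arr Q' j k > 0 \<and> arr Q' k l > 0 \<or> arr Q' l k > 0 \<and> arr Q' k j > 0"
          using False kl ar 1 by auto
        have "chordless_cycle Q' (j # k # l # (r' @ [i]))"
          using chordless_cycle_rotate1[OF 1(3)] Cons by simp
        then have "winds_as_prescribed Q' \<sigma>' (j # k # l # (r' @ [i]))"
          using passing[OF 1(1) _ _ a] C Cons by simp
        then have w: "winds_as_prescribed Q' \<sigma>' C"
          using winds_as_prescribed_rotate1[of Q' \<sigma>' C] C Cons by simp
        \<comment> \<open>A source or sink at \<open>j\<close> prevents an oriented cycle, so the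
          prescribed value is 0 before and after the flip.\<close>
        have zero: "prescribed_wind R C = 0"
          if "quiver R" "arr R j i > 0 \<and> arr R j k > 0 \<or> arr R i j > 0 \<and> arr R k j > 0"
          for R :: "'a quiver"
        proof -
          have no2: "arr R i j = 0 \<or> arr R j i = 0" "arr R j k = 0 \<or> arr R k j = 0"
            using that(1) by (auto simp: quiver_def)
          have E: "(i, j) \<in> cycle_edges C" "(j, k) \<in> cycle_edges C" by (simp_all add: C cycle_edges_def)
          have "\<not> (\<forall>(u, v)\<in>cycle_edges C. arr R u v > 0)"
          proof
            assume "\<forall>(u, v)\<in>cycle_edges C. arr R u v > 0"
            then have "arr R i j > 0" "arr R j k > 0" using E by fast+
            then show False using no2 that(2) by auto
          qed
          moreover have "\<not> (\<forall>(u, v)\<in>cycle_edges C. arr R v u > 0)"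
          proof
            assume "\<forall>(u, v)\<in>cycle_edges C. arr R v u > 0"
            then have "arr R j i > 0" "arr R k j > 0" using E by fast+
            then show False using no2 that(2) by auto
          qed
          ultimately show ?thesis by (simp only: prescribed_wind_conv if_False)
        qed
        have "prescribed_wind Q C = 0" by (rule zero[OF Q alt])
        moreover have "prescribed_wind Q' C = 0"
          by (rule zero) (use 1 alt in \<open>auto simp: totally_proper_coq_def\<close>)
        ultimately show ?thesis using w 1(2,4) C by (simp add: winds_as_prescribed_def)
      qed
    qed
  qed
qed

section \<open>Cochains vanishing on cycles\<close>

text \<open>Some walk from \<open>r\<close> to the next argument has chain \<open>c\<close>, and \<open>e\<close> adds up to \<open>s\<close> along it.\<close>

inductive walk :: "'a quiver \<Rightarrow> ('a \<Rightarrow> 'a \<Rightarrow> int) \<Rightarrow> 'a \<Rightarrow> 'a \<Rightarrow> int \<Rightarrow> ('a \<Rightarrow> 'a \<Rightarrow> int) \<Rightarrow> bool"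
  for Q e r where
  walk_refl: "walk Q e r r 0 (\<lambda>_ _. 0)"
| walk_step: "walk Q e r v s c \<Longrightarrow> adjacent Q v w \<Longrightarrow>
    walk Q e r w (s + e v w) (\<lambda>x y. c x y + (of_bool (v = x \<and> w = y) - of_bool (v = y \<and> w = x)))"

text \<open>The sum runs over ordered pairs, so each edge counts twice; this is the origin of the
  factors 2 below.\<close>

definition pairing :: "'a quiver \<Rightarrow> ('a \<Rightarrow> 'a \<Rightarrow> int) \<Rightarrow> ('a \<Rightarrow> 'a \<Rightarrow> int) \<Rightarrow> int" where
  "pairing Q e c = (\<Sum>u\<in>verts Q. \<Sum>v\<in>verts Q. c u v * e u v)"

lemma pairing_edge:
  assumes "quiver Q" "adjacent Q v w"
  shows "pairing Q e (\<lambda>x y. of_bool (v = x \<and> w = y) - of_bool (v = y \<and> w = x)) = e v w - e w v"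
proof -
  have fin: "finite (verts Q)" using assms(1) by (simp add: quiver_def)
  have vw: "v \<in> verts Q" "w \<in> verts Q" using adjacent_in_verts[OF assms] by auto
  have one: "(\<Sum>x\<in>verts Q. \<Sum>y\<in>verts Q. of_bool (a = x \<and> b = y) * e x y) = e a b"
    if "a \<in> verts Q" "b \<in> verts Q" for a b
  proof -
    have "(\<Sum>x\<in>verts Q. \<Sum>y\<in>verts Q. of_bool (a = x \<and> b = y) * e x y) =
        (\<Sum>x\<in>verts Q. if a = x then (\<Sum>y\<in>verts Q. if b = y then e x y else 0) else 0)"
      by (rule sum.cong[OF HOL.refl]) (auto intro: sum.cong)
    then show ?thesis using that fin by simp
  qed
  show ?thesis
    unfolding pairing_def
    using one[OF vw] one[OF vw(2,1)] by (simp add: left_diff_distrib sum_subtractf conj_commute)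
qed

lemma pairing_add: "pairing Q e (\<lambda>x y. c x y + d x y) = pairing Q e c + pairing Q e d"
  by (simp add: pairing_def sum.distrib distrib_right)

lemma pairing_diff: "pairing Q e (\<lambda>x y. c x y - d x y) = pairing Q e c - pairing Q e d"
  by (simp add: pairing_def sum_subtractf left_diff_distrib)

lemma pairing_mult: "pairing Q e (\<lambda>x y. m * c x y) = m * pairing Q e c"
  by (simp add: pairing_def sum_distrib_left mult.assoc)

lemma pairing_sum: "pairing Q e (\<lambda>x y. \<Sum>i\<in>I. c i x y) = (\<Sum>i\<in>I. pairing Q e (c i))"
  by (induction I rule: infinite_finite_induct) (simp_all add: pairing_add, simp_all add: pairing_def)

lemma pairing_cycle_class:
  assumes "quiver Q" "chordless_cycle Q C" "\<And>u v. adjacent Q u v \<Longrightarrow> e v u = - e u v"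
  shows "pairing Q e (cycle_class C) = 2 * cycle_sum e C"
proof -
  let ?c = "\<lambda>i x y. of_bool (cycle_nth C i = x \<and> cycle_nth C (i + 1) = y) -
      of_bool (cycle_nth C i = y \<and> cycle_nth C (i + 1) = x)"
  have "cycle_class C = (\<lambda>x y. \<Sum>i<length C. ?c i x y)"
    unfolding cycle_class_def ..
  then have "pairing Q e (cycle_class C) = (\<Sum>i<length C. pairing Q e (?c i))"
    by (simp only: pairing_sum)
  also have "\<dots> = (\<Sum>i<length C. 2 * e (cycle_nth C i) (cycle_nth C (i + 1)))"
  proof (rule sum.cong[OF HOL.refl])
    fix i assume "i \<in> {..<length C}"
    then have "adjacent Q (cycle_nth C i) (cycle_nth C (i + 1))"
      using assms(2) by (simp add: chordless_cycle_def graph_cycle_def)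
    then show "pairing Q e (?c i) = 2 * e (cycle_nth C i) (cycle_nth C (i + 1))"
      using pairing_edge[OF assms(1)] assms(3) by simp
  qed
  finally show ?thesis by (simp only: cycle_sum_conv sum_distrib_left)
qed

text \<open>The boundary of the chain is the end of the walk minus its start, so two walks with the
  same ends differ by an element of \<open>H1 Q\<close>, and the pairing recovers the sums along
  them.\<close>

lemma walk_chain:
  assumes Q: "quiver Q" and e: "\<And>u v. adjacent Q u v \<Longrightarrow> e v u = - e u v"
    and "walk Q e r w s c"
  shows "c y x = - c x y" "c x y \<noteq> 0 \<longrightarrow> adjacent Q x y" "pairing Q e c = 2 * s"
    "x \<in> verts Q \<Longrightarrow> (\<Sum>y\<in>verts Q. c y x) = of_bool (x = w) - of_bool (x = r)"
proof -
  have "(\<forall>x y. c y x = - c x y) \<and> (\<forall>x y. c x y \<noteq> 0 \<longrightarrow> adjacent Q x y) \<and> pairing Q e c = 2 * s \<and>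
    (\<forall>x\<in>verts Q. (\<Sum>y\<in>verts Q. c y x) = of_bool (x = w) - of_bool (x = r))"
    using assms(3)
  proof induction
    case walk_refl
    show ?case by (simp add: pairing_def)
  next
    case (walk_step v s c w)
    let ?d = "\<lambda>x y. of_bool (v = x \<and> w = y) - of_bool (v = y \<and> w = x) :: int"
    have vw: "v \<in> verts Q" "w \<in> verts Q" using adjacent_in_verts[OF Q walk_step(2)] by auto
    have fin: "finite (verts Q)" using Q by (simp add: quiver_def)
    have 1: "c y x + ?d y x = - (c x y + ?d x y)" for x y
    proof -
      have "c y x = - c x y" using walk_step.IH by blast
      then show ?thesis by linarith
    qed
    have 2: "c x y + ?d x y \<noteq> 0 \<longrightarrow> adjacent Q x y" for x y
    proof (cases "c x y = 0")
      case True
      then show ?thesis using walk_step(2) adjacent_sym[of Q v w] by (auto split: if_splits)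
    qed (use walk_step.IH in blast)
    have 3: "pairing Q e (\<lambda>x y. c x y + ?d x y) = 2 * (s + e v w)"
    proof -
      have "pairing Q e c = 2 * s" using walk_step.IH by blast
      then show ?thesis
        by (simp only: pairing_add pairing_edge[OF Q walk_step(2)] e[OF walk_step(2)]) simp
    qed
    have one: "(\<Sum>y\<in>verts Q. of_bool (a = y \<and> P)) = (of_bool P :: int)" if "a \<in> verts Q" for a P
      using that fin by (cases P) (simp_all add: of_bool_def)
    have 4: "(\<Sum>y\<in>verts Q. c y x + ?d y x) = of_bool (x = w) - of_bool (x = r)" if "x \<in> verts Q" for x
    proof -
      have "(\<Sum>y\<in>verts Q. c y x) = of_bool (x = v) - of_bool (x = r)" using walk_step.IH that by blast
      moreover have "(\<Sum>y\<in>verts Q. ?d y x) = of_bool (w = x) - of_bool (v = x)"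
        using one[OF vw(1), of "w = x"] one[OF vw(2), of "v = x"]
        by (simp only: sum_subtractf conj_commute[of "v = x"])
      ultimately show ?thesis by (auto simp: sum.distrib)
    qed
    show ?case using 1 2 3 4 by blast
  qed
  note P = this
  show "c y x = - c x y" by (rule P[THEN conjunct1, rule_format])
  show "c x y \<noteq> 0 \<longrightarrow> adjacent Q x y" by (rule P[THEN conjunct2, THEN conjunct1, THEN spec, THEN spec])
  show "pairing Q e c = 2 * s" by (rule P[THEN conjunct2, THEN conjunct2, THEN conjunct1])
  show "x \<in> verts Q \<Longrightarrow> (\<Sum>y\<in>verts Q. c y x) = of_bool (x = w) - of_bool (x = r)"
    by (rule P[THEN conjunct2, THEN conjunct2, THEN conjunct2, rule_format])
qed

text \<open>Integrate \<open>e\<close> along walks from a root in each connected component. The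
  result does not depend on the walk, since the pairing with \<open>e\<close> vanishes on the
  spanning cycles and hence on \<open>H1 Q\<close>.\<close>

lemma cochain_is_coboundary:
  fixes e :: "'a \<Rightarrow> 'a \<Rightarrow> int"
  assumes Q: "quiver Q" and e: "\<And>u v. adjacent Q u v \<Longrightarrow> e v u = - e u v"
    and adm: "admissible_choice Q \<C>" and zero: "\<And>C. C \<in> \<C> \<Longrightarrow> cycle_sum e C = 0"
  obtains h where "\<And>u v. adjacent Q u v \<Longrightarrow> e u v = h v - h u"
proof -
  have H1_zero: "pairing Q e c = 0" if cH: "c \<in> H1 Q" for c
  proof -
    obtain f where f: "c = (\<lambda>u v. \<Sum>C\<in>\<C>. f C * cycle_class C u v)"
      using adm[unfolded admissible_choice_def spans_H1_def, THEN conjunct2, THEN bspec, OF cH] by (rule exE)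
    have "pairing Q e c = (\<Sum>C\<in>\<C>. f C * pairing Q e (cycle_class C))"
      unfolding f by (simp only: pairing_sum pairing_mult)
    also have "\<dots> = 0"
      using adm pairing_cycle_class[OF Q _ e] zero by (intro sum.neutral) (simp add: admissible_choice_def)
    finally show ?thesis .
  qed
  have unique: "s = s'" if w: "walk Q e r v s c" "walk Q e r v s' c'" for r v s s' c c'
  proof -
    note W = walk_chain[OF Q e w(1)] and W' = walk_chain[OF Q e w(2)]
    have "(\<lambda>x y. c x y - c' x y) \<in> H1 Q"
      unfolding H1_def
    proof (intro CollectI conjI allI ballI impI)
      fix x y show "c y x - c' y x = - (c x y - c' x y)" using W(1)[of y x] W'(1)[of y x] by linarith
      show "adjacent Q x y" if "c x y - c' x y \<noteq> 0" using W(2)[of x y] W'(2)[of x y] that by auto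
    next
      fix x assume "x \<in> verts Q"
      then show "(\<Sum>y\<in>verts Q. c y x - c' y x) = 0" using W(4)[of x] W'(4)[of x] by (simp add: sum_subtractf)
    qed
    from H1_zero[OF this] show ?thesis using W(3) W'(3) by (simp add: pairing_diff)
  qed
  define reach where "reach r v \<longleftrightarrow> (\<exists>s c. walk Q e r v s c)" for r v
  have reach_step: "reach r w" if "reach r v" "adjacent Q v w" for r v w
    using that unfolding reach_def by (blast intro: walk_step)
  \<comment> \<open>Adjacent vertices are reachable from the same vertices, so the choice operator
    picks the same root for both.\<close>
  define root where "root v = (SOME r. reach r v)" for v
  have root: "reach (root v) v" for v
    unfolding root_def by (rule someI[of _ v]) (auto simp: reach_def intro: walk_refl)
  define h where "h v = (SOME s. \<exists>c. walk Q e (root v) v s c)" for v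
  have h: "\<exists>c. walk Q e (root v) v (h v) c" for v
    unfolding h_def by (rule someI_ex) (use root[of v] in \<open>simp add: reach_def\<close>)
  show ?thesis
  proof
    fix u v assume uv: "adjacent Q u v"
    then have "reach r u \<longleftrightarrow> reach r v" for r using reach_step adjacent_sym by metis
    then have "root u = root v" by (simp add: root_def)
    moreover obtain c where "walk Q e (root u) u (h u) c" using h by blast
    from walk_step[OF this uv] obtain d where "walk Q e (root u) v (h u + e u v) d" by blast
    moreover obtain d' where "walk Q e (root v) v (h v) d'" using h by blast
    ultimately have "h u + e u v = h v" using unique by metis
    then show "e u v = h v - h u" by simp
  qed
qed

section \<open>Lifts of cyclic orderings to the integers\<close>

text \<open>The integers \<open>x v\<close> reduce modulo the length to the positions in
  \<open>vs\<close>, up to a common shift \<open>c\<close> that absorbs the choice of the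
  cut.\<close>

definition represents :: "('a \<Rightarrow> int) \<Rightarrow> 'a list \<Rightarrow> bool" where
  "represents x vs \<longleftrightarrow> distinct vs \<and>
     (\<exists>c. \<forall>i<length vs. int (length vs) dvd x (vs ! i) - (int i + c))"

lemma represents_rotate:
  assumes "represents x vs"
  shows "represents x (rotate m vs)"
proof -
  let ?n = "length vs"
  obtain c where d: "distinct vs" and c: "\<forall>i<?n. int ?n dvd x (vs ! i) - (int i + c)"
    using assms by (auto simp: represents_def)
  have "int ?n dvd x (rotate m vs ! i) - (int i + (c + int m))" if "i < ?n" for i
  proof -
    let ?i = "(m + i) mod ?n"
    have "?i < ?n" using that by (intro mod_less_divisor) auto
    then have "int ?n dvd x (vs ! ?i) - (int ?i + c)" using c by blast
    moreover have "int ?n dvd int ?i - int (m + i)"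
      by (metis dvd_minus_mod dvd_diff_commute zmod_int)
    ultimately have "int ?n dvd (x (vs ! ?i) - (int ?i + c)) + (int ?i - int (m + i))" by (rule dvd_add)
    then show ?thesis using that by (simp add: nth_rotate algebra_simps)
  qed
  then show ?thesis using d unfolding represents_def length_rotate distinct_rotate by blast
qed

lemma represents_inj:
  assumes "represents x vs" "u \<in> set vs" "v \<in> set vs" "int (length vs) dvd x v - x u"
  shows "u = v"
proof -
  let ?n = "int (length vs)"
  obtain c where c: "\<forall>i<length vs. ?n dvd x (vs ! i) - (int i + c)"
    using assms(1) by (auto simp: represents_def)
  obtain i j where ij: "i < length vs" "vs ! i = u" "j < length vs" "vs ! j = v"
    using assms(2,3) by (auto simp: in_set_conv_nth)
  have "?n dvd (x v - (int j + c)) - (x u - (int i + c))"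
    using dvd_diff[OF c[rule_format, OF ij(3)] c[rule_format, OF ij(1)]] ij by simp
  then have "?n dvd (x v - x u) - ((x v - (int j + c)) - (x u - (int i + c)))"
    by (rule dvd_diff[OF assms(4)])
  then have "?n dvd int j - int i" by simp
  then have "int j mod ?n = int i mod ?n" by (simp add: mod_eq_dvd_iff)
  then show ?thesis using ij by simp
qed

lemma represents_shift_eq:
  assumes "represents x vs" "represents y ws" "set ws = set vs"
    and "\<And>v. v \<in> set vs \<Longrightarrow> y v = x v + K"
  shows "cyc ws = cyc vs"
proof (cases "vs = []")
  case False
  have d: "distinct vs" "distinct ws" using assms by (auto simp: represents_def)
  then have len: "length ws = length vs" using assms(3) by (metis distinct_card)
  let ?n = "int (length vs)"
  have n: "?n > 0" using False by simp
  obtain c where c: "\<forall>i<length vs. ?n dvd x (vs ! i) - (int i + c)"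
    using assms(1) by (auto simp: represents_def)
  obtain c' where c': "\<forall>i<length vs. ?n dvd y (ws ! i) - (int i + c')"
    using assms(2) len by (auto simp: represents_def)
  \<comment> \<open>Modulo the length, \<open>x\<close> is \<open>i + c' - K\<close> at
    \<open>ws ! i\<close> and \<open>p + c\<close> at \<open>vs ! p\<close>, so equal vertices have
    \<open>p\<close> congruent to \<open>i + (c' - K - c)\<close>.\<close>
  define m where "m = nat ((c' - K - c) mod ?n)"
  have m: "?n dvd int m - (c' - K - c)" using n unfolding m_def
    by (simp add: mod_eq_dvd_iff flip: mod_eq_dvd_iff)
  have "ws ! i = rotate m vs ! i" if i: "i < length vs" for i
  proof -
    let ?i = "(m + i) mod length vs"
    have "?i < length vs" using False by simp
    then have a: "?n dvd x (vs ! ?i) - (int ?i + c)" using c by blast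
    have "ws ! i \<in> set vs" using i len assms(3) nth_mem by metis
    then have b: "?n dvd (x (ws ! i) + K) - (int i + c')" using c' i assms(4) by metis
    have e: "?n dvd int ?i - int (m + i)"
      by (metis dvd_minus_mod dvd_diff_commute zmod_int)
    have "?n dvd (x (vs ! ?i) - (int ?i + c)) - ((x (ws ! i) + K) - (int i + c'))
        + (int ?i - int (m + i)) + (int m - (c' - K - c))"
      by (rule dvd_add[OF dvd_add[OF dvd_diff[OF a b] e] m])
    then have "?n dvd x (vs ! ?i) - x (ws ! i)" by (simp add: algebra_simps)
    then have "ws ! i = vs ! ?i"
      using represents_inj[OF assms(1) \<open>ws ! i \<in> set vs\<close>, of "vs ! ?i"] \<open>?i < length vs\<close> nth_mem by blast
    then show ?thesis using i by (simp add: nth_rotate)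
  qed
  then have "ws = rotate m vs" using len by (simp add: list_eq_iff_nth_eq)
  then show ?thesis by simp
next
  case True
  then show ?thesis using assms(3) by simp
qed

section \<open>Connecting two lifts by wiggles\<close>

lemma wiggle_equivalent_refl: "wiggle_equivalent Q \<sigma> \<sigma>"
  by (simp add: wiggle_equivalent_def)

lemma wiggle_equivalent_step:
  "wiggle Q \<sigma> \<tau> \<Longrightarrow> wiggle_equivalent Q \<tau> \<rho> \<Longrightarrow> wiggle_equivalent Q \<sigma> \<rho>"
  unfolding wiggle_equivalent_def by (metis equivclp_trans r_into_equivclp)

text \<open>The values increase weakly from \<open>D 0\<close> to \<open>D (n - 1)\<close>, and the
  closing step \<open>D (n - 1) \<le> D 0\<close> squeezes them.\<close>

lemma cyclically_nondecreasing_const: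
  fixes D :: "nat \<Rightarrow> int"
  assumes "\<And>i. i < n \<Longrightarrow> D i \<le> D (Suc i mod n)" "i < n"
  shows "D i = D 0"
proof -
  have up: "D i \<le> D j" if "i \<le> j" "j < n" for i j
    using that
  proof (induction j rule: dec_induct)
    case (step j)
    then show ?case using assms(1)[of j] by simp
  qed simp
  have "D (n - 1) \<le> D 0" using assms(1)[of "n - 1"] assms(2) by simp
  moreover have "i \<le> n - 1" "n - 1 < n" using assms(2) by auto
  ultimately show ?thesis using up[of 0 i] up[of i "n - 1"] assms(2) by simp
qed

text \<open>The last hypothesis says that along edges the differences of \<open>x\<close> and of
  \<open>y\<close> exceed the same multiples of the length. Exchanges of nonadjacent vertices keep
  it, while the sum of squares of \<open>y - x\<close> drops.\<close>

lemma represents_wiggle_equivalent: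
  assumes "represents x vs" "represents y ws" "set ws = set vs"
    and "\<And>u v k. u \<in> set vs \<Longrightarrow> v \<in> set vs \<Longrightarrow> adjacent Q u v \<Longrightarrow>
      x v > x u + k * int (length vs) \<longleftrightarrow> y v > y u + k * int (length vs)"
  shows "wiggle_equivalent Q (cyc vs) (cyc ws)"
  using assms
proof (induction "nat (\<Sum>v\<in>set vs. (y v - x v)\<^sup>2)" arbitrary: x vs rule: less_induct)
  case less
  let ?n = "int (length vs)"
  let ?D = "\<lambda>v. y v - x v"
  have d: "distinct vs" "distinct ws" using less.prems by (auto simp: represents_def)
  then have len: "length ws = length vs" using less.prems(3) by (metis distinct_card)
  show ?case
  proof (cases "\<forall>i<length vs. ?D (vs ! i) \<le> ?D (vs ! (Suc i mod length vs))")
    case True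
    then have "?D (vs ! i) = ?D (vs ! 0)" if "i < length vs" for i
      using cyclically_nondecreasing_const[of "length vs" "\<lambda>i. ?D (vs ! i)"] that by blast
    then have "y v = x v + ?D (vs ! 0)" if "v \<in> set vs" for v
      using that by (force simp: in_set_conv_nth)
    then have "cyc ws = cyc vs" by (rule represents_shift_eq[OF less.prems(1-3)])
    then show ?thesis by (simp add: wiggle_equivalent_refl)
  next
    case False
    then obtain i where i: "i < length vs" and D: "?D (vs ! i) > ?D (vs ! (Suc i mod length vs))" by force
    define u v where "u = vs ! i" and "v = vs ! (Suc i mod length vs)"
    have "u \<noteq> v" using D unfolding u_def v_def by auto
    have Duv: "?D u > ?D v" using D unfolding u_def v_def .
    have l2: "length vs \<ge> 2"
    proof (rule ccontr)
      assume "\<not> length vs \<ge> 2"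
      then have "length vs = 1" using i by simp
      then show False using i \<open>u \<noteq> v\<close> unfolding u_def v_def by simp
    qed
    have r0: "rotate i vs ! 0 = u" using nth_rotate[of 0 vs i] i by (cases vs) (auto simp: u_def)
    have r1: "rotate i vs ! 1 = v" using nth_rotate[of 1 vs i] l2 by (simp add: v_def)
    obtain zs where zs: "rotate i vs = u # v # zs"
      using r0 r1 l2 by (cases "rotate i vs" rule: remdups_adj.cases) (auto dest: arg_cong[where f = length])
    have sv: "set vs = insert u (insert v (set zs))" using zs set_rotate[of i vs] by simp
    have n: "?n = int (length (u # v # zs))" using zs length_rotate[of i vs] by simp
    have cycvs: "cyc vs = cyc (u # v # zs)" using zs cyc_rotate by metis
    have rep: "represents x (u # v # zs)" using represents_rotate[OF less.prems(1)] zs by metis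
    then obtain c where c: "\<forall>i<length (u # v # zs). ?n dvd x ((u # v # zs) ! i) - (int i + c)"
      and dz: "distinct (u # v # zs)" unfolding represents_def n by blast
    have xu: "?n dvd x u - c" using c[rule_format, of 0] by simp
    have xv: "?n dvd x v - (1 + c)" using c[rule_format, of 1] by simp
    have "?n dvd (x v - (1 + c)) - (x u - c)" using xu xv by (rule dvd_diff[rotated])
    \<comment> \<open>The values at consecutive vertices differ by one modulo \<open>?n\<close>;
      \<open>k\<close> records the number of periods between them.\<close>
    then obtain k where k: "x v = x u + 1 + k * ?n" by (auto simp: dvd_def algebra_simps)
    have inj_x: "\<not> ?n dvd x b - x a" if "a \<in> set vs" "b \<in> set vs" "a \<noteq> b" for a b
      using represents_inj[OF less.prems(1)] that by blast
    have inj_y: "\<not> ?n dvd y b - y a" if "a \<in> set vs" "b \<in> set vs" "a \<noteq> b" for a b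
      using represents_inj[OF less.prems(2), unfolded len less.prems(3)] that by blast
    have uv: "u \<in> set vs" "v \<in> set vs" using sv by auto
    \<comment> \<open>The descent gives \<open>y v \<le> y u + k * ?n\<close> and injectivity
      excludes equality, whereas \<open>x v > x u + k * ?n\<close>; so an edge between
      \<open>u\<close> and \<open>v\<close> would violate the hypothesis.\<close>
    have "y v \<noteq> y u + k * ?n" using inj_y[OF uv \<open>u \<noteq> v\<close>] by auto
    then have yv: "y v < y u + k * ?n" using Duv k by simp
    then have nadj: "\<not> adjacent Q u v" using less.prems(4)[OF uv, of k] k by auto
    \<comment> \<open>As \<open>x v\<close> is congruent to \<open>x u + 1\<close>, these unit
      shifts exchange the two residues while moving the lift as little as possible.\<close>
    define x' where "x' = x(u := x u + 1, v := x v - 1)"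
    have x': "x' u = x u + 1" "x' v = x v - 1" "\<And>w. w \<noteq> u \<Longrightarrow> w \<noteq> v \<Longrightarrow> x' w = x w"
      using \<open>u \<noteq> v\<close> by (auto simp: x'_def)
    have rep': "represents x' (v # u # zs)"
      unfolding represents_def
    proof (intro conjI exI allI impI)
      show "distinct (v # u # zs)" using dz by auto
      fix l assume l: "l < length (v # u # zs)"
      have "?n dvd x' ((v # u # zs) ! l) - (int l + c)"
      proof (cases "l < 2")
        case True
        then have "l = 0 \<or> l = 1" by auto
        then show ?thesis using xu xv x' by (auto simp: algebra_simps)
      next
        case False
        then obtain l' where l': "l = Suc (Suc l')" by (metis add_2_eq_Suc le_Suc_ex not_less)
        then have "zs ! l' \<noteq> u" "zs ! l' \<noteq> v" using dz l nth_mem[of l' zs] by auto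
        then show ?thesis using c[rule_format, of l] l l' x' by simp
      qed
      then show "int (length (v # u # zs)) dvd x' ((v # u # zs) ! l) - (int l + c)" using n by simp
    qed
    \<comment> \<open>A unit shift of \<open>u\<close> affects a comparison only if the other vertex
      has the residue of \<open>v\<close>, and vice versa; by injectivity no third vertex has either
      residue.\<close>
    have ord: "x' b > x' a + m * ?n \<longleftrightarrow> x b > x a + m * ?n"
      if ab: "a \<in> set vs" "b \<in> set vs" "adjacent Q a b" "a \<noteq> b" for a b m
    proof -
      have multiples: "x b \<noteq> x a + m * ?n" if "a \<in> set vs" "b \<in> set vs" "a \<noteq> b" for a b m
        using inj_x[OF that] by auto
      have nv: "\<not> (a = u \<and> b = v)" "\<not> (a = v \<and> b = u)" using ab(3) nadj adjacent_sym by metis+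
      consider "a = u" "b \<noteq> u" "b \<noteq> v" | "a = v" "b \<noteq> u" "b \<noteq> v" | "b = u" "a \<noteq> u" "a \<noteq> v"
        | "b = v" "a \<noteq> u" "a \<noteq> v" | "a \<noteq> u" "a \<noteq> v" "b \<noteq> u" "b \<noteq> v"
        using nv ab(4) by metis
      then show ?thesis
      proof cases
        case 1
        then show ?thesis using multiples[of v b "m - k"] uv ab x' k by (auto simp: algebra_simps)
      next
        case 2
        then show ?thesis using multiples[of v b m] uv ab x' by auto
      next
        case 3
        then show ?thesis using multiples[of a u m] uv ab x' by auto
      next
        case 4
        then show ?thesis using multiples[of a u "m - k"] uv ab x' k by (auto simp: algebra_simps)
      qed (use x' in auto)
    qed
    have sum: "(\<Sum>w\<in>set vs. f w) = f u + f v + (\<Sum>w\<in>set zs. f w)" for f :: "'a \<Rightarrow> int"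
      using dz unfolding sv by (simp add: add.assoc)
    \<comment> \<open>The sum of squares changes by 2 minus twice this gap, so a gap of 1 would not
      give a strict decrease.\<close>
    have gap: "?D u - ?D v \<ge> 2" using yv k by simp
    have "(\<Sum>w\<in>set vs. (y w - x' w)\<^sup>2) < (\<Sum>w\<in>set vs. (y w - x w)\<^sup>2)"
    proof -
      have "(\<Sum>w\<in>set zs. (y w - x' w)\<^sup>2) = (\<Sum>w\<in>set zs. (y w - x w)\<^sup>2)"
      proof (rule sum.cong[OF HOL.refl])
        fix w assume "w \<in> set zs"
        then have "w \<noteq> u" "w \<noteq> v" using dz by auto
        then show "(y w - x' w)\<^sup>2 = (y w - x w)\<^sup>2" using x'(3) by simp
      qed
      moreover have "(y u - x' u)\<^sup>2 + (y v - x' v)\<^sup>2 = (?D u - 1)\<^sup>2 + (?D v + 1)\<^sup>2"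
      proof -
        have "y u - x' u = ?D u - 1" "y v - x' v = ?D v + 1" using x' by auto
        then show ?thesis by (simp only:)
      qed
      moreover have "(?D u - 1)\<^sup>2 + (?D v + 1)\<^sup>2 = (?D u)\<^sup>2 + (?D v)\<^sup>2 - 2 * (?D u - ?D v) + 2"
        by (simp add: power2_eq_square algebra_simps)
      moreover have "A' + S' < A + S" if "S' = S" "A' = B" "B = A - 2 * g + 2" "g \<ge> 2"
        for A A' B S S' g :: int
        using that by linarith
      ultimately show ?thesis unfolding sum using gap by blast
    qed
    moreover have "(\<Sum>w\<in>set vs. (y w - x' w)\<^sup>2) \<ge> 0" by (intro sum_nonneg) auto
    moreover have sv': "set (v # u # zs) = set vs" using sv by auto
    moreover have n': "int (length (v # u # zs)) = ?n" using n by simp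
    ultimately have "wiggle_equivalent Q (cyc (v # u # zs)) (cyc ws)"
    proof (intro less.hyps[where vs = "v # u # zs" and x = x'])
      fix a b m assume ab: "a \<in> set (v # u # zs)" "b \<in> set (v # u # zs)" "adjacent Q a b"
      show "x' b > x' a + m * int (length (v # u # zs)) \<longleftrightarrow> y b > y a + m * int (length (v # u # zs))"
      proof (cases "a = b")
        case False
        then show ?thesis using ord[of a b m] less.prems(4)[of a b m] ab unfolding n' sv' by blast
      qed (use ab in auto)
    qed (use less.prems rep' in auto)
    moreover have "wiggle Q (cyc vs) (cyc (v # u # zs))" unfolding cycvs wiggle_def using nadj by blast
    ultimately show ?thesis by (rule wiggle_equivalent_step[rotated])
  qed
qed

section \<open>Winding numbers determine the ordering up to wiggles\<close>

lemma represents_pos: "distinct vs \<Longrightarrow> represents (\<lambda>v. int (pos vs v) + int (length vs) * h v) vs"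
  unfolding represents_def by (auto simp: pos_nth intro!: exI[of _ 0])

text \<open>The position part of the displacement is a coboundary, so only the passages across the
  cut remain.\<close>

lemma cycle_sum_theta:
  assumes "distinct vs" "set C \<subseteq> set vs"
  shows "cycle_sum (theta (cyc vs)) C =
    int (length vs) * cycle_sum (\<lambda>u v. of_bool (pos vs v < pos vs u)) C"
proof -
  have "cycle_sum (theta (cyc vs)) C = cycle_sum (\<lambda>u v. (int (pos vs v) - int (pos vs u))
      + int (length vs) * of_bool (pos vs v < pos vs u)) C"
  proof (rule cycle_sum_cong)
    fix u v assume "(u, v) \<in> cycle_edges C"
    then have "u \<in> set vs" "v \<in> set vs" using cycle_edges_in_set[of u v C] assms(2) by blast+
    then show "theta (cyc vs) u v = (int (pos vs v) - int (pos vs u))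
      + int (length vs) * of_bool (pos vs v < pos vs u)" by (rule theta_conv[OF assms(1)])
  qed
  then show ?thesis by (simp only: cycle_sum_add cycle_sum_coboundary cycle_sum_mult)
qed

lemma wiggle_equivalent_if_same_winds:
  assumes Q: "quiver Q" and adm: "admissible_choice Q \<C>"
    and co: "cyclic_ordering (verts Q) \<sigma>" "cyclic_ordering (verts Q) \<tau>"
    and same: "\<And>C. C \<in> \<C> \<Longrightarrow> wind Q C \<sigma> = wind Q C \<tau>"
  shows "wiggle_equivalent Q \<sigma> \<tau>"
proof -
  obtain vs where vs: "distinct vs" "set vs = verts Q" "\<sigma> = cyc vs" using co by (auto simp: cyclic_ordering_def)
  obtain ws where ws: "distinct ws" "set ws = verts Q" "\<tau> = cyc ws" using co by (auto simp: cyclic_ordering_def)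
  have len: "length ws = length vs" using vs ws by (metis distinct_card)
  let ?n = "int (length vs)"
  define e :: "'a \<Rightarrow> 'a \<Rightarrow> int" where
    "e u v = of_bool (pos vs v < pos vs u) - of_bool (pos ws v < pos ws u)" for u v
  have ne: "pos vs u \<noteq> pos vs v" "pos ws u \<noteq> pos ws v" if "adjacent Q u v" for u v
    using adjacent_in_verts[OF Q that] vs ws by (simp_all add: pos_eq_iff)
  have "e v u = - e u v" if "adjacent Q u v" for u v
    using ne[OF that] unfolding e_def by (auto simp: of_bool_def)
  moreover have "cycle_sum e C = 0" if C: "C \<in> \<C>" for C
  proof -
    have "chordless_cycle Q C" using adm C by (simp add: admissible_choice_def)
    then have CV: "set C \<subseteq> verts Q" "C \<noteq> []" by (auto simp: chordless_cycle_conv)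
    then have "card (verts Q) > 0" using Q by (auto simp: quiver_def card_gt_0_iff)
    have "?n > 0" using CV vs(2) by (cases vs) auto
    \<comment> \<open>The number of arrows opposing the traversal does not depend on the ordering
      and cancels.\<close>
    have "cycle_sum (theta \<sigma>) C = cycle_sum (theta \<tau>) C"
      using same[OF C] \<open>card (verts Q) > 0\<close>
      unfolding wind_def cycle_sum_conv[symmetric] by simp
    then show ?thesis
      using cycle_sum_theta[OF vs(1)] cycle_sum_theta[OF ws(1)] CV \<open>?n > 0\<close>
      unfolding vs(2,3) ws(2,3) len e_def by (simp add: cycle_sum_diff)
  qed
  ultimately obtain h where h: "\<And>u v. adjacent Q u v \<Longrightarrow> e u v = h v - h u"
    using cochain_is_coboundary[OF Q _ adm] by metis
  \<comment> \<open>Shifting the lift of \<open>vs\<close> by \<open>?n * h\<close> makes up for the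
    different passages across the cuts of \<open>vs\<close> and \<open>ws\<close>.\<close>
  let ?x = "\<lambda>v. int (pos vs v) + ?n * h v" and ?y = "\<lambda>v. int (pos ws v) + int (length ws) * 0"
  have "wiggle_equivalent Q (cyc vs) (cyc ws)"
  proof (rule represents_wiggle_equivalent)
    show "represents ?x vs" "represents ?y ws"
      using represents_pos[OF vs(1), of h] represents_pos[OF ws(1), of "\<lambda>_. 0"] by simp_all
    show "set ws = set vs" using vs ws by simp
    fix u v k assume uv: "u \<in> set vs" "v \<in> set vs" "adjacent Q u v"
    have bound: "pos vs u < length vs" "pos vs v < length vs" "pos ws u < length vs" "pos ws v < length vs"
      using pos_less(1)[OF vs(1)] pos_less(1)[OF ws(1)] uv ws(2) vs(2) len by auto
    \<comment> \<open>The number \<open>p - q\<close>, increased by a period when negative, lies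
      strictly between 0 and \<open>?n\<close>, so only the number \<open>l\<close> of further
      periods matters.\<close>
    have wrap: "int p + (of_bool (p < q) + l) * ?n > int q + k * ?n \<longleftrightarrow> l \<ge> k"
      if "p \<noteq> q" "p < length vs" "q < length vs" for p q l
    proof (cases "l \<ge> k")
      case True
      then have "l * ?n \<ge> k * ?n" by (intro mult_right_mono) auto
      then show ?thesis using True that by (cases "p < q") (auto simp: algebra_simps)
    next
      case False
      then have "(l + 1) * ?n \<le> k * ?n" by (intro mult_right_mono) auto
      then show ?thesis using False that by (cases "p < q") (auto simp: algebra_simps)
    qed
    define a b :: int where "a = of_bool (pos vs v < pos vs u)" and "b = of_bool (pos ws v < pos ws u)"
    have hv: "h v = h u + a - b" using h[OF uv(3)] by (simp add: e_def a_def b_def)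
    \<comment> \<open>Both differences, of \<open>?x\<close> and of \<open>?y\<close>, lie strictly
      between \<open>- b * ?n\<close> and \<open>(1 - b) * ?n\<close>.\<close>
    have "?x v > ?x u + k * ?n \<longleftrightarrow> int (pos vs v) + (a + - b) * ?n > int (pos vs u) + k * ?n"
      unfolding hv by (simp add: algebra_simps)
    also have "\<dots> \<longleftrightarrow> - b \<ge> k"
      unfolding a_def using ne[OF uv(3)] bound by (intro wrap) auto
    also have "\<dots> \<longleftrightarrow> int (pos ws v) + (b + - b) * ?n > int (pos ws u) + k * ?n"
      unfolding b_def using ne[OF uv(3)] bound by (intro wrap[symmetric]) auto
    finally show "?x v > ?x u + k * ?n \<longleftrightarrow> ?y v > ?y u + k * ?n" by (simp add: len)
  qed
  then show ?thesis using vs ws by simp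
qed

theorem proposition14p13:
  fixes Q :: "'a quiver" and \<sigma> :: "'a list set" and \<C> :: "'a list set"
  assumes "quiver Q"
    and "cyclic_ordering (verts Q) \<sigma>"
    and "totally_proper Q \<sigma>"
    and "admissible_choice Q \<C>"
  shows "None \<notin> algorithm_outputs Q \<C> \<and>
         (\<forall>\<sigma>\<^sub>Q. Some \<sigma>\<^sub>Q \<in> algorithm_outputs Q \<C> \<longrightarrow> wiggle_equivalent Q \<sigma>\<^sub>Q \<sigma>)"
proof -
  have tp: "totally_proper_coq Q \<sigma>" using assms by (simp add: totally_proper_coq_def)
  have w: "wind Q C \<sigma> = of_int (prescribed_wind Q C)" if "C \<in> \<C>" for C
  proof -
    have C: "chordless_cycle Q C" using assms(4) that by (simp add: admissible_choice_def)
    show ?thesis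
      using winds_as_prescribed_chordless[OF tp C]
      unfolding wind_eq_iff[OF assms(1) C] winds_as_prescribed_def .
  qed
  then have sol: "\<sigma> \<in> solutions Q \<C>" using assms(2) by (simp add: solutions_def)
  have "wiggle_equivalent Q \<tau> \<sigma>" if "\<tau> \<in> solutions Q \<C>" for \<tau>
    using that w by (intro wiggle_equivalent_if_same_winds[OF assms(1,4) _ assms(2)])
      (simp_all add: solutions_def)
  then show ?thesis using sol by (auto simp: algorithm_outputs_def)
qed

end
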